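(* Let $n\ge 10$, $\sigma\in[0,1)$, let $A,B\sim W(n,\sigma,\mathrm{id})$, and let $X\in\mathcal{P}_n$ be a fixed (non-random) permutation matrix with $\|X-\mathrm{Id}\|_F\le \theta\sqrt n$, where $0\le\theta\le\sqrt{2(1-\frac{10}{n})}$. Put $c(\sigma)=\frac{1}{384}\left(\frac{1-\sigma^2}{1+2\sigma\sqrt{1-\sigma^2}}\right)$. Let $\pi\in\mathcal{S}_n$ be the permutation corresponding to $\tau(AXB)$, i.e. the output of one iteration of PPMGM (the projected power method for graph matching) with input matrices $A,B$ and initial point $X$. Then, for every $r\in[n]$, $$\mathbb{P}\big(\mathrm{overlap}(\pi,\mathrm{id})\ge r/n\big)\ge 1-16\,r\,n\,e^{-c(\sigma)\left(1-\frac{\theta^2}{2}\right)^2n}.$$ In particular, if $|S_X|\ge\sqrt{\tfrac{1}{c(\sigma)}\,n\log(16rn^2)}$, where $S_X=\{i\in[n]:X_{ii}=1\}$, then $$\mathbb{P}\big(\mathrm{overlap}(\pi,\mathrm{id})\ge r/n\big)\ge 1-n^{-1}.$$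
   Context: $[n]=\{1,\dots,n\}$; $\mathcal{S}_n$ is the set of permutations of $[n]$, $\mathcal{P}_n$ the set of $n\times n$ permutation matrices; $X\in\mathcal{P}_n$ corresponds to $x\in\mathcal{S}_n$ via $X_{i,x(i)}=1$. $\mathrm{Id}$, $\mathrm{id}$ are the identity matrix and identity permutation, $\|\cdot\|_F$ is the Frobenius norm. For $\nu,\nu'\in\mathcal{S}_n$, $\mathrm{overlap}(\nu,\nu')=\frac1n|\{i\in[n]:\nu(i)=\nu'(i)\}|$. Correlated Gaussian Wigner model $W(n,\sigma,\mathrm{id})$, $\sigma\in[0,1)$: $A$ is a symmetric random $n\times n$ matrix whose entries $(A_{ij})_{i\le j}$ are independent with $A_{ij}\sim\mathcal{N}(0,\frac1n)$ for $i<j$ and $A_{ii}\sim\mathcal{N}(0,\frac2n)$; $Z$ is an independent copy of $A$; and $B_{ij}=\sqrt{1-\sigma^2}\,A_{ij}+\sigma Z_{ij}$ for all $i,j$. GMWM (greedy maximum weight matching), denoted $\tau$: given $C\in\mathbb{R}^{n\times n}$, select $(i_1,j_1)$ such that $C_{i_1j_1}$ is the largest entry of $C$ (ties broken arbitrarily), discard row $i_1$ and column $j_1$, select the largest entry $(i_2,j_2)$ among the remaining ones, and so on for $n$ steps; $\tau(C)\in\mathcal{P}_n$ is the permutation matrix with ones exactly at $(i_1,j_1),\dots,(i_n,j_n)$. PPMGM with inputs $A,B$, initial point $X^{(0)}$ and $N$ iterations computes $X^{(k+1)}=\tau(AX^{(k)}B)$ for $k=0,\dots,N-1$ and outputs $X^{(N)}$.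 *)

theory Defs
  imports "HOL-Probability.Probability"
begin

text \<open>
  Square matrices of size n are elements of \<open>real ^ 'n ^ 'n\<close> with \<open>n = CARD('n)\<close>; the linear
  order on the index type is only used to speak of the entries on or above the diagonal.
  The library norm on this type is the Frobenius norm.
\<close>

lemma norm_matrix_eq_frobenius:
  fixes X :: "real ^ 'n ^ 'm"
  shows "norm X = sqrt (\<Sum>i\<in>UNIV. \<Sum>j\<in>UNIV. (X $ i $ j)\<^sup>2)"
  by (simp add: norm_vec_def L2_set_def sum_nonneg)

abbreviation perms :: "('n \<Rightarrow> 'n) set" where
  "perms \<equiv> {x. x permutes UNIV}"

definition perm_matrix :: "('n \<Rightarrow> 'n) \<Rightarrow> real ^ 'n ^ 'n" where
  "perm_matrix x = (\<chi> i j. if j = x i then 1 else 0)"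

definition perm_matrices :: "(real ^ 'n ^ 'n) set" where
  "perm_matrices = perm_matrix ` perms"

definition overlap :: "('n::finite \<Rightarrow> 'n) \<Rightarrow> ('n \<Rightarrow> 'n) \<Rightarrow> real" where
  "overlap x y = real (card {i. x i = y i}) / real CARD('n)"

definition fixed_points :: "real ^ 'n ^ 'n \<Rightarrow> 'n set" where
  "fixed_points X = {i. X $ i $ i = 1}"

text \<open>The second parameter of \<open>normal_density\<close> is the standard deviation.\<close>

definition gaussian_wigner ::
  "'a measure \<Rightarrow> ('a \<Rightarrow> real ^ 'n::{finite,linorder} ^ 'n::{finite,linorder}) \<Rightarrow> bool" where
  "gaussian_wigner M A \<longleftrightarrow>
     (\<forall>\<omega>\<in>space M. transpose (A \<omega>) = A \<omega>) \<and>
     prob_space.indep_vars M (\<lambda>_. borel) (\<lambda>(i, j) \<omega>. A \<omega> $ i $ j) {(i, j). i \<le> j} \<and>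
     (\<forall>i j. i < j \<longrightarrow>
        distributed M lborel (\<lambda>\<omega>. A \<omega> $ i $ j) (normal_density 0 (sqrt (1 / real CARD('n))))) \<and>
     (\<forall>i. distributed M lborel (\<lambda>\<omega>. A \<omega> $ i $ i) (normal_density 0 (sqrt (2 / real CARD('n)))))"

text \<open>
  An independent copy \<open>Z\<close> of \<open>A\<close> is a Gaussian Wigner matrix independent of \<open>A\<close> as a matrix-valued
  random variable: the law of such a matrix is determined by \<open>gaussian_wigner\<close>.
\<close>

definition correlated_wigner ::
  "'a measure \<Rightarrow> real \<Rightarrow> ('a \<Rightarrow> real ^ 'n::{finite,linorder} ^ 'n::{finite,linorder}) \<Rightarrow>
   ('a \<Rightarrow> real ^ 'n::{finite,linorder} ^ 'n::{finite,linorder}) \<Rightarrow> bool" where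
  "correlated_wigner M \<sigma> A B \<longleftrightarrow>
     gaussian_wigner M A \<and>
     (\<exists>Z. gaussian_wigner M Z \<and> prob_space.indep_var M borel A borel Z \<and>
          (\<forall>\<omega>\<in>space M. B \<omega> = sqrt (1 - \<sigma>\<^sup>2) *\<^sub>R A \<omega> + \<sigma> *\<^sub>R Z \<omega>))"

text \<open>
  \<open>greedy_run C R S ps\<close>: starting from the remaining rows \<open>R\<close> and columns \<open>S\<close>, the greedy procedure
  may select the entries \<open>ps\<close>, in this order. It is a relation since ties are broken arbitrarily.
\<close>

inductive greedy_run ::
  "real ^ 'n ^ 'n \<Rightarrow> 'n set \<Rightarrow> 'n set \<Rightarrow> ('n \<times> 'n) list \<Rightarrow> bool" for C where
  stop: "greedy_run C {} {} []"
| select: "i \<in> R \<Longrightarrow> j \<in> S \<Longrightarrow> (\<And>i' j'. i' \<in> R \<Longrightarrow> j' \<in> S \<Longrightarrow> C $ i' $ j' \<le> C $ i $ j) \<Longrightarrow>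
    greedy_run C (R - {i}) (S - {j}) ps \<Longrightarrow> greedy_run C R S ((i, j) # ps)"

definition gmwm :: "real ^ 'n ^ 'n \<Rightarrow> real ^ 'n ^ 'n \<Rightarrow> bool" where
  "gmwm C T \<longleftrightarrow>
     (\<exists>ps. greedy_run C UNIV UNIV ps \<and> T = (\<chi> i j. if (i, j) \<in> set ps then 1 else 0))"

text \<open>\<open>ppmgm A B X0 N Y\<close>: \<open>Y\<close> is a possible output after \<open>N\<close> iterations from \<open>X0\<close>.\<close>

inductive ppmgm ::
  "real ^ 'n ^ 'n \<Rightarrow> real ^ 'n ^ 'n \<Rightarrow> real ^ 'n ^ 'n \<Rightarrow> nat \<Rightarrow> real ^ 'n ^ 'n \<Rightarrow> bool"
  for A B X0 where
  init: "ppmgm A B X0 0 X0"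
| iterate: "ppmgm A B X0 k Y \<Longrightarrow> gmwm (A ** Y ** B) T \<Longrightarrow> ppmgm A B X0 (Suc k) T"

lemma ppmgm_one_iff: "ppmgm A B X 1 T \<longleftrightarrow> gmwm (A ** X ** B) T"
  by (auto elim: ppmgm.cases intro: ppmgm.intros)

lemma greedy_run_exists:
  fixes C :: "real ^ 'n ^ 'n"
  assumes "card R = card S"
  shows "\<exists>ps. greedy_run C R S ps"
  using assms
proof (induction "card R" arbitrary: R S)
  case 0
  then have "R = {}" "S = {}" by simp_all
  then show ?case by (auto intro: greedy_run.stop)
next
  case (Suc m)
  have "finite (R \<times> S)" "R \<times> S \<noteq> {}"
    using Suc.hyps(2) Suc.prems by auto
  define f where "f q = C $ fst q $ snd q" for q
  have fin: "finite (f ` (R \<times> S))" and ne: "f ` (R \<times> S) \<noteq> {}"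
    using \<open>finite (R \<times> S)\<close> \<open>R \<times> S \<noteq> {}\<close> by auto
  obtain p where p: "p \<in> R \<times> S" and fp: "f p = Max (f ` (R \<times> S))"
    using Max_in[OF fin ne] by (metis imageE)
  have mx: "\<forall>q\<in>R \<times> S. C $ fst q $ snd q \<le> C $ fst p $ snd p"
    using Max_ge[OF fin] fp unfolding f_def by auto
  obtain i j where ij: "p = (i, j)" by (cases p)
  have "m = card (R - {i})" "card (R - {i}) = card (S - {j})"
    using Suc.hyps(2)[symmetric] Suc.prems p ij by (auto simp: card_Diff_singleton)
  then obtain ps where "greedy_run C (R - {i}) (S - {j}) ps"
    using Suc.hyps(1)[of "R - {i}" "S - {j}"] by blast
  then have "greedy_run C R S ((i, j) # ps)"
    using p mx ij by (intro greedy_run.select) auto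
  then show ?case by blast
qed

lemma gmwm_exists: "\<exists>T. gmwm C T"
  unfolding gmwm_def using greedy_run_exists[of UNIV UNIV C] by blast

lemma greedy_run_bij:
  assumes "greedy_run C R S ps"
  shows "(\<forall>(i, j)\<in>set ps. i \<in> R \<and> j \<in> S) \<and> (\<forall>i\<in>R. \<exists>!j. (i, j) \<in> set ps) \<and>
         (\<forall>j\<in>S. \<exists>!i. (i, j) \<in> set ps)"
  using assms
proof induction
  case stop
  then show ?case by simp
next
  case (select i R j S ps)
  show ?case
  proof (intro conjI)
    show "\<forall>(a, b)\<in>set ((i, j) # ps). a \<in> R \<and> b \<in> S"
      using select by auto
    show "\<forall>a\<in>R. \<exists>!b. (a, b) \<in> set ((i, j) # ps)"
    proof
      fix a assume "a \<in> R"
      then show "\<exists>!b. (a, b) \<in> set ((i, j) # ps)"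
        using select.IH by (cases "a = i") auto
    qed
    show "\<forall>b\<in>S. \<exists>!a. (a, b) \<in> set ((i, j) # ps)"
    proof
      fix b assume "b \<in> S"
      then show "\<exists>!a. (a, b) \<in> set ((i, j) # ps)"
        using select.IH by (cases "b = j") auto
    qed
  qed
qed

lemma gmwm_perm_matrix:
  assumes "gmwm C T"
  shows "T \<in> perm_matrices"
proof -
  obtain ps where ps: "greedy_run C UNIV UNIV ps"
    and T: "T = (\<chi> i j. if (i, j) \<in> set ps then 1 else 0)"
    using assms by (auto simp: gmwm_def)
  have row: "\<exists>!j. (i, j) \<in> set ps" and col: "\<exists>!i. (i, j) \<in> set ps" for i j
    using greedy_run_bij[OF ps] by auto
  define x where "x i = (THE j. (i, j) \<in> set ps)" for i
  have x: "(i, j) \<in> set ps \<longleftrightarrow> j = x i" for i j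
    using theI'[OF row[of i]] row[of i] unfolding x_def by blast
  have "bij x"
    unfolding bij_def inj_def surj_def using col by (metis x)
  then have "x permutes UNIV"
    by (intro bij_imp_permutes) auto
  moreover have "T = perm_matrix x"
    by (simp add: T perm_matrix_def x)
  ultimately show ?thesis
    by (auto simp: perm_matrices_def)
qed

definition rate_const :: "real \<Rightarrow> real" where
  "rate_const \<sigma> = 1 / 384 * ((1 - \<sigma>\<^sup>2) / (1 + 2 * \<sigma> * sqrt (1 - \<sigma>\<^sup>2)))"

end

theory Submission
  imports Defs
begin

text \<open>
  Write \<open>x\<close> for the permutation of \<open>X\<close>, \<open>a = sqrt (1 - \<sigma>\<^sup>2)\<close> and \<open>s = |S_X| / n\<close>. The entries of
  \<open>C = A X B\<close> are \<open>C i j = (\<Sum>k. A i k * (a * A (x k) j + \<sigma> * Z (x k) j))\<close>. The greedy procedure selects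
  \<open>(i, i)\<close> as soon as \<open>C i i\<close> strictly dominates its row and its column, so a union bound over \<open>r\<close>
  arbitrary indices reduces the claim to \<open>C i i > t\<close> and \<open>C i j < t\<close> for \<open>t = 37/100 * a * s\<close>.
  On the diagonal the fixed points of \<open>x\<close> contribute a sum of squares of mean at least \<open>s\<close>. All
  remaining terms are split into boundedly many sums of products of independent centred Gaussians
  with pairwise disjoint factors, whose exponential moments are explicit; for the non-fixed points
  on the diagonal this splitting is a 3-colouring of the cycles of \<open>x\<close>.
\<close>

subsection \<open>Exponential moments and tails of Gaussian products\<close>

lemma nn_integral_normal_density_eq_1:
  assumes "0 < s"
  shows "(\<integral>\<^sup>+x. ennreal (normal_density m s x) \<partial>lborel) = 1"
  using assms by (simp add: nn_integral_eq_integral)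

text \<open>The factor \<open>exp (\<theta> * x\<^sup>2)\<close> only rescales the Gaussian: the
  integrand is \<open>1 / sqrt D\<close> times the normal density with standard deviation
  \<open>s / sqrt D\<close>, where \<open>D\<close> is positive by \<open>d\<close>.\<close>

lemma nn_integral_normal_exp_square:
  assumes s: "0 < s" and d: "2 * \<theta> * s\<^sup>2 < 1"
  shows "(\<integral>\<^sup>+x. ennreal (normal_density 0 s x) * ennreal (exp (\<theta> * x\<^sup>2)) \<partial>lborel)
    = ennreal (1 / sqrt (1 - 2 * \<theta> * s\<^sup>2))"
proof -
  define D where "D = 1 - 2 * \<theta> * s\<^sup>2"
  have D: "D > 0" using d by (simp add: D_def)
  have sd: "normal_density 0 s x * exp (\<theta> * x\<^sup>2) = 1 / sqrt D * normal_density 0 (s / sqrt D) x" for x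
  proof -
    have "- x\<^sup>2 / (2 * s\<^sup>2) + \<theta> * x\<^sup>2 = - x\<^sup>2 / (2 * (s / sqrt D)\<^sup>2)"
      using s D by (simp add: power_divide D_def field_simps)
    then show ?thesis
      using s D by (simp add: normal_density_def power_divide real_sqrt_divide real_sqrt_mult
          mult_exp_exp)
  qed
  have "(\<integral>\<^sup>+x. ennreal (normal_density 0 s x) * ennreal (exp (\<theta> * x\<^sup>2)) \<partial>lborel)
     = (\<integral>\<^sup>+x. ennreal (1 / sqrt D) * ennreal (normal_density 0 (s / sqrt D) x) \<partial>lborel)"
    using D by (intro nn_integral_cong) (simp add: ennreal_mult'[symmetric] sd del: times_divide_eq_left)
  also have "\<dots> = ennreal (1 / sqrt D)"
    using s D by (subst nn_integral_cmult) (simp_all add: nn_integral_normal_density_eq_1)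
  finally show ?thesis by (simp add: D_def)
qed

text \<open>Completing the square: the tilt by \<open>exp (l * x)\<close> moves the mean to
  \<open>l * s\<^sup>2\<close> and leaves the variance unchanged.\<close>

lemma nn_integral_normal_exp_linear:
  assumes s: "0 < s"
  shows "(\<integral>\<^sup>+x. ennreal (normal_density 0 s x) * ennreal (exp (l * x)) \<partial>lborel)
    = ennreal (exp (l\<^sup>2 * s\<^sup>2 / 2))"
proof -
  have sd: "normal_density 0 s x * exp (l * x) = exp (l\<^sup>2 * s\<^sup>2 / 2) * normal_density (l * s\<^sup>2) s x" for x
  proof -
    have "- x\<^sup>2 / (2 * s\<^sup>2) + l * x = l\<^sup>2 * s\<^sup>2 / 2 + - (x - l * s\<^sup>2)\<^sup>2 / (2 * s\<^sup>2)"
      using s by (simp add: field_simps power2_eq_square)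
    then show ?thesis
      using s by (simp add: normal_density_def mult_exp_exp)
  qed
  have "(\<integral>\<^sup>+x. ennreal (normal_density 0 s x) * ennreal (exp (l * x)) \<partial>lborel)
     = (\<integral>\<^sup>+x. ennreal (exp (l\<^sup>2 * s\<^sup>2 / 2)) * ennreal (normal_density (l * s\<^sup>2) s x) \<partial>lborel)"
    by (intro nn_integral_cong) (simp add: ennreal_mult'[symmetric] sd)
  also have "\<dots> = ennreal (exp (l\<^sup>2 * s\<^sup>2 / 2))"
    using s by (subst nn_integral_cmult) (simp_all add: nn_integral_normal_density_eq_1)
  finally show ?thesis .
qed

lemma exp_square_mgf:
  assumes "distributed M lborel X (normal_density 0 s)" "0 < s" "2 * \<theta> * s\<^sup>2 < 1"
  shows "(\<integral>\<^sup>+\<omega>. ennreal (exp (\<theta> * (X \<omega>)\<^sup>2)) \<partial>M) = ennreal (1 / sqrt (1 - 2 * \<theta> * s\<^sup>2))"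
  using distributed_nn_integral[OF assms(1), of "\<lambda>x. ennreal (exp (\<theta> * x\<^sup>2))"]
    nn_integral_normal_exp_square[OF assms(2,3)] by simp

text \<open>Turns the exact moments \<open>1 / sqrt (1 - x)\<close> into sub-Gaussian form. On
  \<open>[0, 1/4]\<close> one has
  \<open>1 / (1 - x) \<le> 1 + 4 / 3 * x \<le> exp (4 / 3 * x)\<close>; then take square
  roots.\<close>

lemma inv_sqrt_le_exp:
  fixes x :: real
  assumes "x \<le> 1 / 4"  "0 \<le> x"
  shows "1 / sqrt (1 - x) \<le> exp (2 / 3 * x)"
proof -
  have "1 / (1 - x) = 1 + x / (1 - x)" using assms by (simp add: field_simps)
  also have "x / (1 - x) \<le> 4 / 3 * x"
  proof -
    have "x * (1/4 - x) \<ge> 0" using assms by (intro mult_nonneg_nonneg) auto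
    then show ?thesis using assms by (simp add: field_simps)
  qed
  also have "1 + 4 / 3 * x \<le> exp (4 / 3 * x)" by simp
  finally have "1 / (1 - x) \<le> exp (4 / 3 * x)" by simp
  then have "sqrt (1 / (1 - x)) \<le> sqrt (exp (4 / 3 * x))" by simp
  also have "sqrt (exp (4 / 3 * x)) = exp (2 / 3 * x)"
    by (rule real_sqrt_unique) (simp_all flip: exp_of_nat_mult exp_double)
  finally show ?thesis by (simp add: real_sqrt_divide)
qed

section \<open>Exponential moments of independent products and Chernoff bounds\<close>

context prob_space
begin

text \<open>Integrating out \<open>Y\<close> first leaves
  \<open>exp (l\<^sup>2 * t\<^sup>2 / 2 * (X \<omega>)\<^sup>2)\<close>, the exponential of a
  square, whose moment is known.\<close>

lemma exp_product_mgf: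
  assumes X: "distributed M lborel X (normal_density 0 s)" and s: "0 < s"
    and Y: "distributed M lborel Y (normal_density 0 t)" and t: "0 < t"
    and ind: "indep_var borel X borel Y" and l: "l\<^sup>2 * s\<^sup>2 * t\<^sup>2 < 1"
  shows "(\<integral>\<^sup>+\<omega>. ennreal (exp (l * (X \<omega> * Y \<omega>))) \<partial>M) = ennreal (1 / sqrt (1 - l\<^sup>2 * s\<^sup>2 * t\<^sup>2))"
proof -
  have [measurable]: "random_variable borel X" "random_variable borel Y"
    using indep_var_rv1[OF ind] indep_var_rv2[OF ind] by auto
  interpret Y: prob_space "distr M borel Y" by (rule prob_space_distr) simp
  have inner: "(\<integral>\<^sup>+y. ennreal (exp (l * (x * y))) \<partial>distr M borel Y) = ennreal (exp ((l\<^sup>2 * t\<^sup>2 / 2) * x\<^sup>2))" for x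
  proof -
    have "(\<integral>\<^sup>+y. ennreal (exp (l * (x * y))) \<partial>distr M borel Y) = (\<integral>\<^sup>+\<omega>. ennreal (exp ((l * x) * Y \<omega>)) \<partial>M)"
      by (simp add: nn_integral_distr mult.assoc)
    also have "\<dots> = ennreal (exp ((l * x)\<^sup>2 * t\<^sup>2 / 2))"
      using distributed_nn_integral[OF Y, of "\<lambda>y. ennreal (exp ((l * x) * y))"]
        nn_integral_normal_exp_linear[OF t, of "l * x"] by simp
    finally show ?thesis by (simp add: power_mult_distrib mult_ac)
  qed
  have "(\<integral>\<^sup>+\<omega>. ennreal (exp (l * (X \<omega> * Y \<omega>))) \<partial>M)
    = (\<integral>\<^sup>+p. ennreal (exp (l * (fst p * snd p))) \<partial>distr M (borel \<Otimes>\<^sub>M borel) (\<lambda>\<omega>. (X \<omega>, Y \<omega>)))"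
    by (subst nn_integral_distr) auto
  also have "\<dots> = (\<integral>\<^sup>+p. ennreal (exp (l * (fst p * snd p))) \<partial>(distr M borel X \<Otimes>\<^sub>M distr M borel Y))"
    using ind by (simp add: indep_var_distribution_eq)
  also have "\<dots> = (\<integral>\<^sup>+x. \<integral>\<^sup>+y. ennreal (exp (l * (x * y))) \<partial>distr M borel Y \<partial>distr M borel X)"
    by (subst Y.nn_integral_fst[symmetric]) auto
  also have "\<dots> = (\<integral>\<^sup>+\<omega>. ennreal (exp ((l\<^sup>2 * t\<^sup>2 / 2) * (X \<omega>)\<^sup>2)) \<partial>M)"
    by (simp add: inner nn_integral_distr)
  also have "\<dots> = ennreal (1 / sqrt (1 - l\<^sup>2 * s\<^sup>2 * t\<^sup>2))"
    using exp_square_mgf[OF X s, of "l\<^sup>2 * t\<^sup>2 / 2"] l by (simp add: mult_ac)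
  finally show ?thesis .
qed

lemma indep_vars_block:
  assumes "indep_vars (\<lambda>_. borel) W I" "disjoint_family_on K L" "\<And>k. k \<in> L \<Longrightarrow> K k \<subseteq> I"
    and "\<And>k. k \<in> L \<Longrightarrow> f k \<in> borel_measurable (PiM (K k) (\<lambda>_. borel))"
  shows "indep_vars (\<lambda>_. borel) (\<lambda>k \<omega>. f k (restrict (\<lambda>i. W i \<omega>) (K k))) L"
  using indep_vars_compose2[OF indep_vars_restrict[OF assms(1,3,2)] assms(4)] by simp

lemma indep_var_pair:
  assumes "indep_vars (\<lambda>_. borel) W I" "i \<in> I" "j \<in> I" "i \<noteq> j"
  shows "indep_var borel (W i) borel (W j)"
proof -
  have "indep_var borel ((\<lambda>w. w i) \<circ> (\<lambda>\<omega>. restrict (\<lambda>k. W k \<omega>) {i}))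
      borel ((\<lambda>w. w j) \<circ> (\<lambda>\<omega>. restrict (\<lambda>k. W k \<omega>) {j}))"
    by (rule indep_var_compose[OF indep_var_restrict[OF assms(1)]]) (use assms in auto)
  then show ?thesis by (simp add: comp_def)
qed

text \<open>Disjoint pairs make the products for different \<open>k\<close> independent, so the
  moment factorises; \<open>e k \<noteq> e' k\<close> makes the two factors of each product
  independent. The assumption \<open>small\<close> brings each exact moment into the range of
  \<open>inv_sqrt_le_exp\<close>.\<close>

lemma exp_sum_products_mgf:
  assumes ind: "indep_vars (\<lambda>_. borel) W I"
    and dist: "\<And>i. i \<in> I \<Longrightarrow> distributed M lborel (W i) (normal_density 0 (sd i))"
    and pos: "\<And>i. i \<in> I \<Longrightarrow> 0 < sd i"
    and G: "finite G" and e: "\<And>k. k \<in> G \<Longrightarrow> e k \<in> I \<and> e' k \<in> I \<and> e k \<noteq> e' k"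
    and disj: "disjoint_family_on (\<lambda>k. {e k, e' k}) G"
    and small: "\<And>k. k \<in> G \<Longrightarrow> l\<^sup>2 * (sd (e k) * sd (e' k))\<^sup>2 \<le> 1 / 4"
  shows "(\<integral>\<^sup>+\<omega>. ennreal (exp (l * (\<Sum>k\<in>G. W (e k) \<omega> * W (e' k) \<omega>))) \<partial>M)
    \<le> ennreal (exp (2 / 3 * l\<^sup>2 * (\<Sum>k\<in>G. (sd (e k) * sd (e' k))\<^sup>2)))"
proof -
  have "indep_vars (\<lambda>_. borel)
      (\<lambda>k \<omega>. (\<lambda>w. ennreal (exp (l * (w (e k) * w (e' k))))) (restrict (\<lambda>i. W i \<omega>) {e k, e' k})) G"
    by (rule indep_vars_block[OF ind disj]) (use e in auto)
  then have ind': "indep_vars (\<lambda>_. borel) (\<lambda>k \<omega>. ennreal (exp (l * (W (e k) \<omega> * W (e' k) \<omega>)))) G"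
    by simp
  have "(\<integral>\<^sup>+\<omega>. ennreal (exp (l * (\<Sum>k\<in>G. W (e k) \<omega> * W (e' k) \<omega>))) \<partial>M)
    = (\<integral>\<^sup>+\<omega>. (\<Prod>k\<in>G. ennreal (exp (l * (W (e k) \<omega> * W (e' k) \<omega>)))) \<partial>M)"
    by (simp add: sum_distrib_left exp_sum G prod_ennreal)
  also have "\<dots> = (\<Prod>k\<in>G. \<integral>\<^sup>+\<omega>. ennreal (exp (l * (W (e k) \<omega> * W (e' k) \<omega>))) \<partial>M)"
    by (rule indep_vars_nn_integral[OF G ind']) simp
  also have "\<dots> \<le> (\<Prod>k\<in>G. ennreal (exp (2 / 3 * (l\<^sup>2 * (sd (e k) * sd (e' k))\<^sup>2))))"
  proof (rule prod_mono_ennreal)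
    fix k assume k: "k \<in> G"
    have lt: "l\<^sup>2 * (sd (e k))\<^sup>2 * (sd (e' k))\<^sup>2 < 1"
      using small[OF k] by (simp add: power_mult_distrib mult.assoc)
    have "(\<integral>\<^sup>+\<omega>. ennreal (exp (l * (W (e k) \<omega> * W (e' k) \<omega>))) \<partial>M)
        = ennreal (1 / sqrt (1 - l\<^sup>2 * (sd (e k))\<^sup>2 * (sd (e' k))\<^sup>2))"
      by (rule exp_product_mgf) (use e[OF k] dist pos lt indep_var_pair[OF ind] in auto)
    also have "\<dots> \<le> ennreal (exp (2 / 3 * (l\<^sup>2 * (sd (e k) * sd (e' k))\<^sup>2)))"
      using inv_sqrt_le_exp[OF small[OF k]]
      by (intro ennreal_leI) (simp add: power_mult_distrib mult.assoc)
    finally show "(\<integral>\<^sup>+\<omega>. ennreal (exp (l * (W (e k) \<omega> * W (e' k) \<omega>))) \<partial>M)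
      \<le> ennreal (exp (2 / 3 * (l\<^sup>2 * (sd (e k) * sd (e' k))\<^sup>2)))" .
  qed
  also have "\<dots> = ennreal (exp (2 / 3 * l\<^sup>2 * (\<Sum>k\<in>G. (sd (e k) * sd (e' k))\<^sup>2)))"
    by (simp add: prod_ennreal G exp_sum[symmetric] sum_distrib_left mult.assoc)
  finally show ?thesis .
qed

lemma prob_ge_le_mgf:
  fixes f :: "'a \<Rightarrow> real"
  assumes "0 < l" and [measurable]: "random_variable borel f"
    and "(\<integral>\<^sup>+\<omega>. ennreal (exp (l * f \<omega>)) \<partial>M) \<le> ennreal c" and "0 \<le> c"
  shows "prob {\<omega>\<in>space M. t \<le> f \<omega>} \<le> exp (- l * t) * c"
proof -
  have "emeasure M {\<omega>\<in>space M. t \<le> f \<omega>}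
    \<le> ennreal (exp (- l * t)) * (\<integral>\<^sup>+\<omega>. ennreal (exp (l * f \<omega>)) * indicator (space M) \<omega> \<partial>M)"
    by (rule Chernoff_ineq_nn_integral_ge) (use assms in auto)
  also have "(\<integral>\<^sup>+\<omega>. ennreal (exp (l * f \<omega>)) * indicator (space M) \<omega> \<partial>M) = (\<integral>\<^sup>+\<omega>. ennreal (exp (l * f \<omega>)) \<partial>M)"
    by (intro nn_integral_cong) simp
  also have "ennreal (exp (- l * t)) * \<dots> \<le> ennreal (exp (- l * t)) * ennreal c"
    using assms by (intro mult_left_mono) auto
  also have "\<dots> = ennreal (exp (- l * t) * c)" using assms by (simp add: ennreal_mult)
  finally show ?thesis using assms by (simp add: emeasure_eq_measure)
qed

lemma sum_products_tails:
  fixes n :: real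
  assumes ind: "indep_vars (\<lambda>_. borel) W I"
    and dist: "\<And>i. i \<in> I \<Longrightarrow> distributed M lborel (W i) (normal_density 0 (sd i))"
    and pos: "\<And>i. i \<in> I \<Longrightarrow> 0 < sd i"
    and G: "finite G" and e: "\<And>k. k \<in> G \<Longrightarrow> e k \<in> I \<and> e' k \<in> I \<and> e k \<noteq> e' k"
    and disj: "disjoint_family_on (\<lambda>k. {e k, e' k}) G"
    and n: "0 < n" and sd: "\<And>i. i \<in> I \<Longrightarrow> (sd i)\<^sup>2 \<le> 2 / n"
    and total: "(\<Sum>k\<in>G. (sd (e k) * sd (e' k))\<^sup>2) \<le> 2 / n"
    and t: "0 < t" "t \<le> 2 / 3"
  shows "prob {\<omega>\<in>space M. t \<le> (\<Sum>k\<in>G. W (e k) \<omega> * W (e' k) \<omega>)} \<le> exp (- 3 / 16 * n * t\<^sup>2)"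
    and "prob {\<omega>\<in>space M. (\<Sum>k\<in>G. W (e k) \<omega> * W (e' k) \<omega>) \<le> - t} \<le> exp (- 3 / 16 * n * t\<^sup>2)"
proof -
  let ?S = "\<lambda>\<omega>. \<Sum>k\<in>G. W (e k) \<omega> * W (e' k) \<omega>"
  have rv: "i \<in> I \<Longrightarrow> random_variable borel (W i)" for i
    using ind by (auto simp: indep_vars_def)
  have meas[measurable]: "random_variable borel ?S"
    using rv e by (intro borel_measurable_sum borel_measurable_times) auto
  \<comment> \<open>With total variance at most \<open>2 / n\<close> the exponent is at most
    \<open>- l * t + 4 / 3 * l\<^sup>2 / n\<close>; this \<open>l\<close> minimises it and yields
    \<open>- 3 / 16 * n * t\<^sup>2\<close>. The bound \<open>t \<le> 2 / 3\<close> keeps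
    \<open>l\<^sup>2 * (2 / n)\<^sup>2\<close> at most \<open>1 / 4\<close>.\<close>
  define l where "l = 3 * t / 8 * n"
  have l: "0 < l" using t n by (simp add: l_def)
  have lsq: "l\<^sup>2 = 9 * t\<^sup>2 / 64 * n\<^sup>2" by (simp add: l_def power_mult_distrib power_divide)
  have t2: "t\<^sup>2 \<le> 4 / 9" using power_mono[OF t(2), of 2] t by (simp add: power_divide)
  have small: "l\<^sup>2 * (sd (e k) * sd (e' k))\<^sup>2 \<le> 1 / 4" if "k \<in> G" for k
  proof -
    have "(sd (e k) * sd (e' k))\<^sup>2 \<le> (2 / n) * (2 / n)"
      unfolding power_mult_distrib using e[OF that] n by (intro mult_mono sd) auto
    then have "l\<^sup>2 * (sd (e k) * sd (e' k))\<^sup>2 \<le> l\<^sup>2 * ((2 / n) * (2 / n))"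
      by (intro mult_left_mono) auto
    also have "\<dots> = 9 / 16 * t\<^sup>2" using n unfolding lsq by (simp add: power2_eq_square)
    finally show ?thesis using t2 by simp
  qed
  have bound: "exp (- l * t) * exp (2 / 3 * l\<^sup>2 * (\<Sum>k\<in>G. (sd (e k) * sd (e' k))\<^sup>2)) \<le> exp (- 3 / 16 * n * t\<^sup>2)"
  proof -
    have "2 / 3 * l\<^sup>2 * (\<Sum>k\<in>G. (sd (e k) * sd (e' k))\<^sup>2) \<le> 2 / 3 * l\<^sup>2 * (2 / n)"
      using total by (intro mult_left_mono) auto
    also have "\<dots> = 3 / 16 * n * t\<^sup>2" using n unfolding lsq by (simp add: power2_eq_square)
    finally show ?thesis
      by (simp add: mult_exp_exp l_def power2_eq_square algebra_simps)
  qed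
  \<comment> \<open>The moment bound depends on the parameter only through its square, so
    \<open>l\<close> and \<open>- l\<close> serve the upper and the lower tail alike.\<close>
  have mgf: "(\<integral>\<^sup>+\<omega>. ennreal (exp (q * ?S \<omega>)) \<partial>M)
      \<le> ennreal (exp (2 / 3 * l\<^sup>2 * (\<Sum>k\<in>G. (sd (e k) * sd (e' k))\<^sup>2)))" if "q = l \<or> q = - l" for q
    using exp_sum_products_mgf[OF ind dist pos G e disj, of q] small that by auto
  show "prob {\<omega>\<in>space M. t \<le> ?S \<omega>} \<le> exp (- 3 / 16 * n * t\<^sup>2)"
    using prob_ge_le_mgf[OF l meas mgf[of l]] bound by (meson exp_ge_zero order_trans)
  have "prob {\<omega>\<in>space M. t \<le> - ?S \<omega>} \<le> exp (- l * t) * exp (2 / 3 * l\<^sup>2 * (\<Sum>k\<in>G. (sd (e k) * sd (e' k))\<^sup>2))"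
    by (rule prob_ge_le_mgf[OF l]) (use mgf[of "- l"] in auto)
  also have "{\<omega>\<in>space M. t \<le> - ?S \<omega>} = {\<omega>\<in>space M. ?S \<omega> \<le> - t}" by auto
  finally show "prob {\<omega>\<in>space M. ?S \<omega> \<le> - t} \<le> exp (- 3 / 16 * n * t\<^sup>2)"
    using bound by linarith
qed

lemma square_upper_tail:
  fixes n :: real
  assumes X: "distributed M lborel X (normal_density 0 s)" and s: "0 < s" "s\<^sup>2 \<le> 2 / n" and n: "0 < n"
  shows "prob {\<omega>\<in>space M. u \<le> (X \<omega>)\<^sup>2} \<le> 3 / 2 * exp (- n * u / 8)"
proof -
  have [measurable]: "random_variable borel X" using X by (auto simp: distributed_def)
  \<comment> \<open>For \<open>s\<^sup>2 \<le> 2 / n\<close> the parameter \<open>n / 8\<close> uses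
    at most half of the admissible range, so the moment is at most \<open>sqrt 2\<close>.\<close>
  have half: "2 * (n / 8) * s\<^sup>2 \<le> 1 / 2" using s n by (simp add: field_simps)
  have "1 / sqrt (1 - 2 * (n / 8) * s\<^sup>2) \<le> 1 / sqrt (1 / 2)"
    using half by (intro divide_left_mono mult_pos_pos real_sqrt_le_mono) auto
  also have "\<dots> = sqrt 2" by (simp add: real_sqrt_divide)
  also have "\<dots> \<le> 3 / 2" by (rule real_le_lsqrt) (auto simp: power2_eq_square)
  finally have "(\<integral>\<^sup>+\<omega>. ennreal (exp (n / 8 * (X \<omega>)\<^sup>2)) \<partial>M) \<le> ennreal (3 / 2)"
    using exp_square_mgf[OF X s(1), of "n / 8"] half by (simp add: ennreal_leI)
  from prob_ge_le_mgf[OF _ _ this, of u] show ?thesis using n by (simp add: mult_ac)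
qed

text \<open>A product is at most the larger of the two squares, so two tails of squares suffice. The
  factors may be dependent or even equal, as can happen for the term split off from the off-diagonal
  sums.\<close>

lemma single_product_tail:
  fixes n :: real
  assumes X: "distributed M lborel X (normal_density 0 s)" and s: "0 < s" "s\<^sup>2 \<le> 2 / n"
    and Y: "distributed M lborel Y (normal_density 0 t)" and t: "0 < t" "t\<^sup>2 \<le> 2 / n" and n: "0 < n"
  shows "prob {\<omega>\<in>space M. u \<le> X \<omega> * Y \<omega>} \<le> 3 * exp (- n * u / 8)"
proof -
  have [measurable]: "random_variable borel X" "random_variable borel Y"
    using X Y by (auto simp: distributed_def)
  have "u \<le> x\<^sup>2 \<or> u \<le> y\<^sup>2" if "u \<le> x * y" for x y :: real
    using that sum_squares_bound[of x y] by argo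
  then have "prob {\<omega>\<in>space M. u \<le> X \<omega> * Y \<omega>}
      \<le> prob ({\<omega>\<in>space M. u \<le> (X \<omega>)\<^sup>2} \<union> {\<omega>\<in>space M. u \<le> (Y \<omega>)\<^sup>2})"
    by (intro finite_measure_mono) auto
  also have "\<dots> \<le> prob {\<omega>\<in>space M. u \<le> (X \<omega>)\<^sup>2} + prob {\<omega>\<in>space M. u \<le> (Y \<omega>)\<^sup>2}"
    by (intro measure_Un_le) auto
  also have "\<dots> \<le> 3 * exp (- n * u / 8)"
    using square_upper_tail[OF X s n, of u] square_upper_tail[OF Y t n, of u] by simp
  finally show ?thesis .
qed

text \<open>Chernoff bound for the negative of the sum. A larger variance only decreases the mean of
  \<open>exp (- l * (W i \<omega>)\<^sup>2)\<close>, which is why the variances are bounded from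
  below here.\<close>

lemma sum_squares_lower_tail:
  fixes n g :: real
  assumes ind: "indep_vars (\<lambda>_. borel) W I"
    and dist: "\<And>i. i \<in> I \<Longrightarrow> distributed M lborel (W i) (normal_density 0 (sd i))"
    and pos: "\<And>i. i \<in> I \<Longrightarrow> 0 < sd i"
    and G: "finite G" and e: "e ` G \<subseteq> I" "inj_on e G"
    and n: "0 < n" and sd: "\<And>i. i \<in> I \<Longrightarrow> 1 / n \<le> (sd i)\<^sup>2"
    and g: "0 < g" "g \<le> 1"
  shows "prob {\<omega>\<in>space M. (\<Sum>k\<in>G. (W (e k) \<omega>)\<^sup>2) \<le> (1 - g) * (card G / n)} \<le> exp (- real (card G) * g\<^sup>2 / 8)"
proof -
  let ?S = "\<lambda>\<omega>. \<Sum>k\<in>G. (W (e k) \<omega>)\<^sup>2"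
  have rv: "i \<in> I \<Longrightarrow> random_variable borel (W i)" for i
    using ind by (auto simp: indep_vars_def)
  have meas[measurable]: "random_variable borel ?S"
    using rv e by (intro borel_measurable_sum borel_measurable_power) auto
  \<comment> \<open>With this \<open>l\<close> each moment is at most
    \<open>1 / sqrt (1 + g / 2)\<close>, and \<open>ln (1 + y) \<ge> y - y\<^sup>2\<close> at
    \<open>y = g / 2\<close> bounds it by \<open>c\<close> below. The net exponent per term is
    \<open>g / 4 * (1 - g) - (g / 4 - g\<^sup>2 / 8) = - g\<^sup>2 / 8\<close>.\<close>
  define l where "l = g / 4 * n"
  have l: "0 < l" using g n by (simp add: l_def)
  have eI: "e k \<in> I" if "k \<in> G" for k using e that by auto
  have "indep_vars (\<lambda>_. borel)
      (\<lambda>k \<omega>. (\<lambda>w. ennreal (exp (- l * (w (e k))\<^sup>2))) (restrict (\<lambda>i. W i \<omega>) {e k})) G"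
    by (rule indep_vars_block[OF ind]) (use e eI in \<open>auto simp: disjoint_family_on_def inj_on_def\<close>)
  then have ind': "indep_vars (\<lambda>_. borel) (\<lambda>k \<omega>. ennreal (exp (- l * (W (e k) \<omega>)\<^sup>2))) G"
    by simp
  define c where "c = exp (- (g / 4 - g\<^sup>2 / 8))"
  have mgf1: "(\<integral>\<^sup>+\<omega>. ennreal (exp (- l * (W i \<omega>)\<^sup>2)) \<partial>M) \<le> ennreal c" if i: "i \<in> I" for i
  proof -
    have "g / 2 - (g / 2)\<^sup>2 \<le> ln (1 + g / 2)" using g by (intro ln_one_plus_pos_lower_bound) auto
    then have "exp (g / 2 - (g / 2)\<^sup>2) \<le> 1 + g / 2" using g by (simp add: ln_ge_iff)
    also have "\<dots> \<le> 1 + 2 * l * (sd i)\<^sup>2"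
      using sd[OF i] n g by (simp add: l_def field_simps)
    finally have "sqrt (exp (g / 2 - (g / 2)\<^sup>2)) \<le> sqrt (1 + 2 * l * (sd i)\<^sup>2)" by simp
    also have "sqrt (exp (g / 2 - (g / 2)\<^sup>2)) = exp (g / 4 - g\<^sup>2 / 8)"
      by (rule real_sqrt_unique)
        (auto simp: power2_eq_square mult_exp_exp field_simps)
    finally have "1 / sqrt (1 + 2 * l * (sd i)\<^sup>2) \<le> 1 / exp (g / 4 - g\<^sup>2 / 8)"
      using l by (intro divide_left_mono mult_pos_pos) (auto intro!: add_pos_nonneg)
    also have "\<dots> = c" by (simp add: c_def exp_minus inverse_eq_divide exp_diff)
    finally have "1 / sqrt (1 + 2 * l * (sd i)\<^sup>2) \<le> c" .
    moreover have "0 \<le> l * (sd i)\<^sup>2" using l by simp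
    ultimately show ?thesis
      using exp_square_mgf[OF dist[OF i] pos[OF i], of "- l"] by (simp add: ennreal_leI)
  qed
  have "(\<integral>\<^sup>+\<omega>. ennreal (exp (l * - ?S \<omega>)) \<partial>M)
    = (\<integral>\<^sup>+\<omega>. (\<Prod>k\<in>G. ennreal (exp (- l * (W (e k) \<omega>)\<^sup>2))) \<partial>M)"
    by (simp add: sum_distrib_left exp_sum G prod_ennreal flip: sum_negf)
  also have "\<dots> = (\<Prod>k\<in>G. \<integral>\<^sup>+\<omega>. ennreal (exp (- l * (W (e k) \<omega>)\<^sup>2)) \<partial>M)"
    by (rule indep_vars_nn_integral[OF G ind']) simp
  also have "\<dots> \<le> (\<Prod>k\<in>G. ennreal c)"
    by (rule prod_mono_ennreal) (use mgf1 eI in auto)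
  also have "\<dots> = ennreal (c ^ card G)" by (simp add: ennreal_power c_def)
  finally have mgf: "(\<integral>\<^sup>+\<omega>. ennreal (exp (l * - ?S \<omega>)) \<partial>M) \<le> ennreal (c ^ card G)" .
  have "prob {\<omega>\<in>space M. - ((1 - g) * (card G / n)) \<le> - ?S \<omega>}
      \<le> exp (- l * - ((1 - g) * (card G / n))) * c ^ card G"
    by (rule prob_ge_le_mgf[OF l _ mgf]) (auto simp: c_def)
  also have "\<dots> = exp (- real (card G) * g\<^sup>2 / 8)"
    using n by (simp add: c_def l_def mult_exp_exp flip: exp_of_nat_mult)
       (simp add: field_simps power2_eq_square)
  finally show ?thesis by simp
qed

end

subsection \<open>Greedy matching and permutation matrices\<close>

text \<open>While \<open>(i, i)\<close> is available, a selection in row \<open>i\<close> or column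
  \<open>i\<close> must have a value of at least \<open>C $ i $ i\<close>, and strict dominance
  leaves only \<open>(i, i)\<close> itself; any other selection keeps it available. Strictness makes
  the conclusion independent of the tie-breaking.\<close>

lemma greedy_run_selects_dominant:
  assumes "greedy_run C R S ps" "i \<in> R" "i \<in> S"
    and "\<And>j. j \<noteq> i \<Longrightarrow> C $ i $ j < C $ i $ i \<and> C $ j $ i < C $ i $ i"
  shows "(i, i) \<in> set ps"
  using assms
proof induction
  case stop
  then show ?case by simp
next
  case (select a R b S ps)
  show ?case
  proof (cases "a = i \<or> b = i")
    case True
    with select.hyps(3)[OF select.prems(1,2)] select.prems(3) have "a = i \<and> b = i"
      by (metis not_less)
    then show ?thesis by simp
  next
    case False
    with select show ?thesis by auto
  qed
qed

lemma gmwm_fixes_dominant: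
  assumes "gmwm C (perm_matrix p)"
    and "\<And>j. j \<noteq> i \<Longrightarrow> C $ i $ j < C $ i $ i \<and> C $ j $ i < C $ i $ i"
  shows "p i = i"
proof -
  obtain ps where ps: "greedy_run C UNIV UNIV ps"
    and T: "perm_matrix p = (\<chi> i j. if (i, j) \<in> set ps then 1 else 0)"
    using assms(1) by (auto simp: gmwm_def)
  have "(i, i) \<in> set ps" by (rule greedy_run_selects_dominant[OF ps]) (use assms(2) in auto)
  then have "perm_matrix p $ i $ i = 1" by (simp add: T)
  then show ?thesis by (simp add: perm_matrix_def split: if_splits)
qed

lemma perm_matrix_sandwich:
  fixes A B :: "real ^ 'n ^ 'n"
  shows "(A ** perm_matrix x ** B) $ i $ j = (\<Sum>k\<in>UNIV. A $ i $ k * B $ x k $ j)"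
proof -
  have "(A ** perm_matrix x ** B) $ i $ j
      = (\<Sum>l\<in>UNIV. \<Sum>k\<in>UNIV. A $ i $ k * ((if l = x k then 1 else 0) * B $ l $ j))"
    by (simp add: matrix_matrix_mult_def perm_matrix_def sum_distrib_right mult.assoc)
  also have "\<dots> = (\<Sum>k\<in>UNIV. \<Sum>l\<in>UNIV. A $ i $ k * ((if l = x k then 1 else 0) * B $ l $ j))"
    by (rule sum.swap)
  also have "\<dots> = (\<Sum>k\<in>UNIV. A $ i $ k * B $ x k $ j)"
    by (intro sum.cong refl) (simp add: if_distrib[of "\<lambda>z. z * _"] if_distrib[of "\<lambda>z. _ * z"] cong: if_cong)
  finally show ?thesis .
qed

lemma fixed_points_perm_matrix: "fixed_points (perm_matrix x) = {k. x k = k}"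
  by (auto simp: fixed_points_def perm_matrix_def split: if_splits)

text \<open>A row of a non-fixed point has exactly two nonzero entries, 1 and -1. This converts the
  Frobenius hypothesis into a count of fixed points.\<close>

lemma norm_perm_matrix_diff:
  fixes x :: "'n::finite \<Rightarrow> 'n"
  shows "(norm (perm_matrix x - mat 1))\<^sup>2 = 2 * (real CARD('n) - real (card {k. x k = k}))"
proof -
  have row: "(\<Sum>j\<in>UNIV. ((perm_matrix x - mat 1) $ i $ j)\<^sup>2) = (if x i = i then 0 else 2)" for i
  proof (cases "x i = i")
    case True
    then show ?thesis by (auto simp: perm_matrix_def mat_def intro!: sum.neutral)
  next
    case False
    have "(\<Sum>j\<in>UNIV. ((perm_matrix x - mat 1) $ i $ j)\<^sup>2)
        = (\<Sum>j\<in>UNIV. (if j = x i then 1 else 0) + (if j = i then 1 else 0 :: real))"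
      using False by (intro sum.cong) (auto simp: perm_matrix_def mat_def)
    also have "\<dots> = 2" by (simp add: sum.distrib)
    finally show ?thesis using False by simp
  qed
  have "(norm (perm_matrix x - mat 1))\<^sup>2 = (\<Sum>i\<in>UNIV. if x i = i then 0 else 2)"
    by (simp only: norm_matrix_eq_frobenius row) (simp add: sum_nonneg)
  also have "\<dots> = 2 * real (card {k. x k \<noteq> k})"
    by (simp add: sum.If_cases Compl_eq flip: Collect_neg_eq)
  also have "card {k. x k \<noteq> k} = CARD('n) - card {k. x k = k}"
    by (simp add: Collect_neg_eq Compl_eq_Diff_UNIV card_Diff_subset)
  finally show ?thesis by (simp add: of_nat_diff card_mono)
qed

text \<open>A permutation seen as a graph with edges \<open>{k, x k}\<close> has maximal degree 2, so greedy colouring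
  needs three colours.\<close>

lemma perm_three_colouring:
  fixes x :: "'n::finite \<Rightarrow> 'n"
  assumes "inj x"
  obtains c :: "'n \<Rightarrow> nat" where "\<And>k. c k < 3" "\<And>k. x k \<noteq> k \<Longrightarrow> c (x k) \<noteq> c k"
proof -
  \<comment> \<open>Only edges inside \<open>T\<close> have to be coloured properly, so a new vertex
    \<open>e\<close> can be recoloured without affecting them.\<close>
  have "\<exists>c. (\<forall>k. c k < (3::nat)) \<and> (\<forall>k. k \<in> T \<and> x k \<in> T \<and> x k \<noteq> k \<longrightarrow> c (x k) \<noteq> c k)"
    if "finite T" for T
    using that
  proof (induction T)
    case empty
    show ?case by (intro exI[of _ "\<lambda>_. 0"]) simp
  next
    case (insert e T)
    then obtain c :: "'n \<Rightarrow> nat" where c: "\<forall>k. c k < 3" "\<forall>k. k \<in> T \<and> x k \<in> T \<and> x k \<noteq> k \<longrightarrow> c (x k) \<noteq> c k"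
      by blast
    have "card {c (x e), c (inv x e)} \<le> 2" by (simp add: card_insert_le_m1)
    then have "\<not> {..<3} \<subseteq> {c (x e), c (inv x e)}"
      using card_mono[of "{c (x e), c (inv x e)}" "{..<3::nat}"] by auto
    then obtain d where d: "d < 3" "d \<noteq> c (x e)" "d \<noteq> c (inv x e)" by auto
    have "x k = e \<Longrightarrow> inv x e = k" for k using inv_f_f[OF assms] by auto
    then show ?case using c d insert.hyps(2)
      by (intro exI[of _ "c(e := d)"]) auto
  qed
  from this[of UNIV] show ?thesis using that by auto
qed

section \<open>Joint independence of two families that depend on independent variables\<close>

context prob_space
begin

text \<open>The model gives independence of the entries within each matrix and independence of the
  two matrices as wholes; this merges the two into independence of all entries. An event about
  finitely many \<open>U i\<close> and \<open>V j\<close> is an event about \<open>X\<close>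
  intersected with one about \<open>Y\<close>, so it factors first across \<open>X\<close> and
  \<open>Y\<close> and then within each family.\<close>

lemma indep_vars_combine:
  assumes U: "indep_vars (\<lambda>_. borel) U I" and V: "indep_vars (\<lambda>_. borel) V J"
    and ind: "indep_var S X T Y"
    and UX: "\<And>i. i \<in> I \<Longrightarrow> \<exists>f\<in>borel_measurable S. U i = f \<circ> X"
    and VY: "\<And>j. j \<in> J \<Longrightarrow> \<exists>g\<in>borel_measurable T. V j = g \<circ> Y"
  shows "indep_vars (\<lambda>_. borel) (case_sum U V) (I <+> J)"
proof -
  obtain f where f: "\<And>i. i \<in> I \<Longrightarrow> f i \<in> borel_measurable S" "\<And>i. i \<in> I \<Longrightarrow> U i = f i \<circ> X"
    using UX by metis
  obtain g where g: "\<And>j. j \<in> J \<Longrightarrow> g j \<in> borel_measurable T" "\<And>j. j \<in> J \<Longrightarrow> V j = g j \<circ> Y"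
    using VY by metis
  have XY: "X \<in> measurable M S" "Y \<in> measurable M T"
    using indep_var_rv1[OF ind] indep_var_rv2[OF ind] by auto
  have rU: "random_variable borel (U i)" if "i \<in> I" for i using U that by (auto simp: indep_vars_def)
  have rV: "random_variable borel (V i)" if "i \<in> J" for i using V that by (auto simp: indep_vars_def)
  show ?thesis
    unfolding indep_vars_def2
  proof (intro conjI ballI indep_setsI)
    fix k assume "k \<in> I <+> J"
    then show "random_variable borel (case_sum U V k)" using rU rV by auto
  next
    fix k assume "k \<in> I <+> J"
    then show "{case_sum U V k -` A \<inter> space M |A. A \<in> sets borel} \<subseteq> events"
      using rU rV by (auto intro: measurable_sets)
  next
    fix E K
    assume K: "K \<noteq> {}" "K \<subseteq> I <+> J" "finite K"
      and "\<forall>k\<in>K. E k \<in> {case_sum U V k -` A \<inter> space M |A. A \<in> sets borel}"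
    then obtain A where A: "\<And>k. k \<in> K \<Longrightarrow> A k \<in> sets borel"
      and E: "\<And>k. k \<in> K \<Longrightarrow> E k = case_sum U V k -` A k \<inter> space M"
      by simp metis
    define KI where "KI = {i. Inl i \<in> K}"
    define KJ where "KJ = {j. Inr j \<in> K}"
    have Keq: "K = Inl ` KI \<union> Inr ` KJ"
    proof -
      have "k \<in> Inl ` KI \<union> Inr ` KJ" if "k \<in> K" for k
        using that by (cases k) (auto simp: KI_def KJ_def)
      then show ?thesis by (auto simp: KI_def KJ_def)
    qed
    have fin: "finite KI" "finite KJ"
      using K(3) finite_vimageI[of K Inl] finite_vimageI[of K Inr]
      by (auto simp: KI_def KJ_def vimage_def)
    have sub: "KI \<subseteq> I" "KJ \<subseteq> J" using K(2) by (auto simp: KI_def KJ_def)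
    \<comment> \<open>Intersecting with \<open>space S\<close> covers the case
      \<open>KI = {}\<close>, where the inner intersection is \<open>UNIV\<close>.\<close>
    define PX where "PX = (\<Inter>i\<in>KI. f i -` A (Inl i) \<inter> space S) \<inter> space S"
    define PY where "PY = (\<Inter>j\<in>KJ. g j -` A (Inr j) \<inter> space T) \<inter> space T"
    have PX: "PX \<in> sets S"
    proof (cases "KI = {}")
      case False
      have "f i -` A (Inl i) \<inter> space S \<in> sets S" if "i \<in> KI" for i
        using that sub f(1) A by (intro measurable_sets[of _ _ borel]) (auto simp: KI_def)
      then show ?thesis
        unfolding PX_def by (rule sets.Int[OF sets.finite_INT[OF fin(1) False] sets.top])
    qed (simp add: PX_def)
    have PY: "PY \<in> sets T"
    proof (cases "KJ = {}")
      case False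
      have "g j -` A (Inr j) \<inter> space T \<in> sets T" if "j \<in> KJ" for j
        using that sub g(1) A by (intro measurable_sets[of _ _ borel]) (auto simp: KJ_def)
      then show ?thesis
        unfolding PY_def by (rule sets.Int[OF sets.finite_INT[OF fin(2) False] sets.top])
    qed (simp add: PY_def)
    have XS: "X w \<in> space S" "Y w \<in> space T" if "w \<in> space M" for w
      using XY that by (auto dest: measurable_space)
    have Uf: "U i w = f i (X w)" if "i \<in> KI" for i w using f(2) sub(1) that by auto
    have Vg: "V j w = g j (Y w)" if "j \<in> KJ" for j w using g(2) sub(2) that by auto
    have EX: "X -` PX \<inter> space M = (\<Inter>i\<in>KI. U i -` A (Inl i) \<inter> space M) \<inter> space M"
      using XS(1) Uf by (auto simp: PX_def)
    have EY: "Y -` PY \<inter> space M = (\<Inter>j\<in>KJ. V j -` A (Inr j) \<inter> space M) \<inter> space M"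
      using XS(2) Vg by (auto simp: PY_def)
    have EI: "E (Inl i) = U i -` A (Inl i) \<inter> space M" if "i \<in> KI" for i
      using E that by (auto simp: KI_def)
    have EJ: "E (Inr j) = V j -` A (Inr j) \<inter> space M" if "j \<in> KJ" for j
      using E that by (auto simp: KJ_def)
    have "(\<Inter>k\<in>K. E k) = (\<Inter>k\<in>K. E k) \<inter> space M" using K(1) E by auto
    also have "\<dots> = ((\<Inter>i\<in>KI. E (Inl i)) \<inter> space M) \<inter> ((\<Inter>j\<in>KJ. E (Inr j)) \<inter> space M)"
      unfolding Keq by auto
    also have "\<dots> = (X -` PX \<inter> space M) \<inter> (Y -` PY \<inter> space M)"
      unfolding EX EY using EI EJ by simp
    also have "\<dots> = (\<lambda>w. (X w, Y w)) -` (PX \<times> PY) \<inter> space M" by auto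
    also have "prob \<dots> = prob (X -` PX \<inter> space M) * prob (Y -` PY \<inter> space M)"
      by (rule indep_varD[OF ind PX PY])
    also have "prob (X -` PX \<inter> space M) = (\<Prod>i\<in>KI. prob (U i -` A (Inl i) \<inter> space M))"
    proof (cases "KI = {}")
      case False
      then have "X -` PX \<inter> space M = (\<Inter>i\<in>KI. U i -` A (Inl i) \<inter> space M)"
        unfolding EX by auto
      then show ?thesis
        using indep_varsD[OF U False fin(1) sub(1), of "\<lambda>i. A (Inl i)"] A by (simp add: KI_def)
    qed (simp add: EX prob_space)
    also have "prob (Y -` PY \<inter> space M) = (\<Prod>j\<in>KJ. prob (V j -` A (Inr j) \<inter> space M))"
    proof (cases "KJ = {}")
      case False
      then have "Y -` PY \<inter> space M = (\<Inter>j\<in>KJ. V j -` A (Inr j) \<inter> space M)"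
        unfolding EY by auto
      then show ?thesis
        using indep_varsD[OF V False fin(2) sub(2), of "\<lambda>i. A (Inr i)"] A by (simp add: KJ_def)
    qed (simp add: EY prob_space)
    also have "(\<Prod>i\<in>KI. prob (U i -` A (Inl i) \<inter> space M)) * (\<Prod>j\<in>KJ. prob (V j -` A (Inr j) \<inter> space M))
        = (\<Prod>k\<in>K. prob (E k))"
      unfolding Keq using fin EI EJ by (subst prod.union_disjoint) (auto simp: prod.reindex)
    finally show "prob (\<Inter>k\<in>K. E k) = (\<Prod>k\<in>K. prob (E k))" .
  qed
qed

end

subsection \<open>Entries of the matrix product\<close>

lemma rate_const_pos:
  assumes "0 \<le> \<sigma>" "\<sigma> < 1"
  shows "0 < rate_const \<sigma>"
proof -
  have "\<sigma>\<^sup>2 < 1" using assms by (simp add: power_less_one_iff)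
  then show ?thesis using assms by (auto simp: rate_const_def intro!: divide_pos_pos add_pos_nonneg)
qed

text \<open>The denominator in \<open>rate_const\<close> is at least 1. All tail bounds below are
  compared with this simpler rate.\<close>

lemma rate_const_le:
  assumes "0 \<le> \<sigma>" "\<sigma> < 1"
  shows "rate_const \<sigma> \<le> (1 - \<sigma>\<^sup>2) / 384"
proof -
  have s: "\<sigma>\<^sup>2 < 1" using assms by (simp add: power_less_one_iff)
  then have "(1 - \<sigma>\<^sup>2) / (1 + 2 * \<sigma> * sqrt (1 - \<sigma>\<^sup>2)) \<le> (1 - \<sigma>\<^sup>2) / 1"
    using assms by (intro divide_left_mono mult_pos_pos add_pos_nonneg) auto
  then show ?thesis unfolding rate_const_def by linarith
qed

text \<open>Two forms for two scales of thresholds: \<open>s\<close> for sums of products within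
  \<open>A\<close>, and \<open>sqrt (1 - \<sigma>\<^sup>2) * s\<close> for sums of products with
  \<open>Z\<close>.\<close>

lemma rate_const_exponent_le:
  assumes "0 \<le> \<sigma>" "\<sigma> < 1" "0 \<le> n"
  shows "rate_const \<sigma> * s\<^sup>2 * n \<le> s\<^sup>2 * n / 384"
    and "rate_const \<sigma> * s\<^sup>2 * n \<le> (sqrt (1 - \<sigma>\<^sup>2) * s)\<^sup>2 * n / 384"
proof -
  have "\<sigma>\<^sup>2 < 1" using assms by (simp add: power_less_one_iff)
  then have a: "(sqrt (1 - \<sigma>\<^sup>2))\<^sup>2 = 1 - \<sigma>\<^sup>2" by simp
  have "rate_const \<sigma> * (s\<^sup>2 * n) \<le> (1 - \<sigma>\<^sup>2) / 384 * (s\<^sup>2 * n)"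
    using assms by (intro mult_right_mono rate_const_le) auto
  then show *: "rate_const \<sigma> * s\<^sup>2 * n \<le> (sqrt (1 - \<sigma>\<^sup>2) * s)\<^sup>2 * n / 384"
    by (simp add: power_mult_distrib a mult.assoc)
  have "(1 - \<sigma>\<^sup>2) * (s\<^sup>2 * n) \<le> 1 * (s\<^sup>2 * n)"
    using assms by (intro mult_right_mono) auto
  with * show "rate_const \<sigma> * s\<^sup>2 * n \<le> s\<^sup>2 * n / 384"
    by (simp add: power_mult_distrib a mult.assoc)
qed

text \<open>The threshold constant \<open>3 / 25\<close> works because
  \<open>3 / 16 * (3 / 25)\<^sup>2 = 27 / 10000\<close> exceeds \<open>1 / 384\<close>.\<close>

lemma exp_product_tail_le:
  fixes n s e :: real
  assumes "0 \<le> n" "e \<le> s\<^sup>2 * n / 384"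
  shows "exp (- 3 / 16 * n * (3 / 25 * s)\<^sup>2) \<le> exp (- e)"
proof -
  have "- 3 / 16 * n * (3 / 25 * s)\<^sup>2 = - (27 / 10000) * (s\<^sup>2 * n)"
    by (simp add: power2_eq_square)
  moreover have "0 \<le> s\<^sup>2 * n" using assms by simp
  ultimately show ?thesis unfolding exp_le_cancel_iff using assms by linarith
qed

text \<open>Unordered pairs are represented on or above the diagonal, the index set used in
  \<open>gaussian_wigner\<close>. Coincidences between entries of a symmetric matrix then become
  equations between indices.\<close>

definition upair :: "'b::linorder \<Rightarrow> 'b \<Rightarrow> 'b \<times> 'b" where
  "upair i j = (min i j, max i j)"

lemma upair_eq_iff: "upair a b = upair c d \<longleftrightarrow> a = c \<and> b = d \<or> a = d \<and> b = c"
  by (auto simp: upair_def min_def max_def split: if_splits)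

lemma upair_mem: "upair a b \<in> {(i, j). i \<le> j}"
  by (auto simp: upair_def min_def max_def)

definition entry_sd :: "'n::finite \<times> 'n \<Rightarrow> real" where
  "entry_sd p = sqrt ((if fst p = snd p then 2 else 1) / real CARD('n))"

lemma entry_sd_upair:
  fixes i j :: "'n::{finite,linorder}"
  shows "(entry_sd (upair i j))\<^sup>2 = (1 + of_bool (i = j)) / real CARD('n)"
  by (auto simp: entry_sd_def upair_def min_def max_def)

lemma gaussian_wigner_symmetric:
  assumes "gaussian_wigner M A" "\<omega> \<in> space M"
  shows "A \<omega> $ j $ i = A \<omega> $ i $ j"
proof -
  have "A \<omega> = transpose (A \<omega>)" using assms by (simp add: gaussian_wigner_def)
  then show ?thesis by (metis transpose_def vec_lambda_beta)
qed

lemma gaussian_wigner_upair: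
  assumes "gaussian_wigner M A" "\<omega> \<in> space M"
  shows "(case upair i j of (i, j) \<Rightarrow> \<lambda>\<omega>. A \<omega> $ i $ j) \<omega> = A \<omega> $ i $ j"
  using gaussian_wigner_symmetric[OF assms, of j i] by (simp add: upair_def min_def max_def)

lemma gaussian_wigner_entry_distributed:
  fixes A :: "'a \<Rightarrow> real ^ 'n::{finite,linorder} ^ 'n::{finite,linorder}"
  assumes "gaussian_wigner M A" "p \<in> {(i, j). i \<le> j}"
  shows "distributed M lborel (case p of (i, j) \<Rightarrow> \<lambda>\<omega>. A \<omega> $ i $ j) (normal_density 0 (entry_sd p))"
  using assms by (cases "fst p = snd p") (auto simp: gaussian_wigner_def entry_sd_def)

text \<open>For \<open>p\<close>, \<open>q\<close> in {0, 1} one has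
  \<open>(1 + p) * (1 + q) \<le> 1 + 2 * p + q\<close>, and each indicator holds for a single
  \<open>k\<close>. The total is thus at most \<open>(n + 3) / n\<^sup>2\<close>, and
  \<open>n \<ge> 3\<close> gives the variance budget required by
  \<open>sum_products_tails\<close>.\<close>

lemma sum_variance_products_le:
  fixes x :: "'n::finite \<Rightarrow> 'n"
  assumes x: "inj x" and n: "3 \<le> CARD('n)"
  shows "(\<Sum>k\<in>G. (1 + of_bool (i = k)) / real CARD('n) * ((1 + of_bool (x k = j)) / real CARD('n)))
    \<le> 2 / real CARD('n)"
proof -
  let ?n = "real CARD('n)"
  have npos: "?n > 0" by simp
  have "(\<Sum>k\<in>G. (1 + of_bool (i = k)) / ?n * ((1 + of_bool (x k = j)) / ?n))
      \<le> (\<Sum>k\<in>UNIV. (1 + of_bool (i = k)) / ?n * ((1 + of_bool (x k = j)) / ?n))"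
    by (intro sum_mono2) auto
  also have "\<dots> \<le> (\<Sum>k\<in>UNIV. (1 + 2 * of_bool (k = i) + of_bool (k = inv x j)) / ?n\<^sup>2)"
    by (intro sum_mono) (auto simp: power2_eq_square divide_right_mono inv_f_f[OF x] inj_eq[OF x])
  also have "\<dots> = (?n + 3) / ?n\<^sup>2"
    by (simp add: sum_divide_distrib[symmetric] sum.distrib sum_distrib_left[symmetric] of_bool_def)
  also have "\<dots> \<le> 2 / ?n"
    using n npos by (simp add: power2_eq_square field_simps)
  finally show ?thesis .
qed

section \<open>The joint Gaussian family of the entries of \<open>A\<close> and
  \<open>Z\<close>\<close>

locale independent_wigner_pair = prob_space M for M :: "'a measure" +
  fixes A Z :: "'a \<Rightarrow> real ^ 'n::{finite,linorder} ^ 'n::{finite,linorder}"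
  assumes A: "gaussian_wigner M A" and Z: "gaussian_wigner M Z"
    and ind: "indep_var borel A borel Z"
begin

text \<open>The sum type keeps the two copies of the index set apart, so a single independent family
  covers both matrices and one tail lemma serves products within \<open>A\<close> as well as
  products with \<open>Z\<close>.\<close>

definition entry :: "('n \<times> 'n) + ('n \<times> 'n) \<Rightarrow> 'a \<Rightarrow> real" where
  "entry = case_sum (\<lambda>(i, j) \<omega>. A \<omega> $ i $ j) (\<lambda>(i, j) \<omega>. Z \<omega> $ i $ j)"

abbreviation entries :: "(('n \<times> 'n) + ('n \<times> 'n)) set" where
  "entries \<equiv> {(i, j). i \<le> j} <+> {(i, j). i \<le> j}"

definition sd :: "('n \<times> 'n) + ('n \<times> 'n) \<Rightarrow> real" where
  "sd = case_sum entry_sd entry_sd"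

lemma entry_measurable[measurable]:
  "(\<lambda>\<omega>. A \<omega> $ i $ j) \<in> borel_measurable M" "(\<lambda>\<omega>. Z \<omega> $ i $ j) \<in> borel_measurable M"
  using indep_var_rv1[OF ind] indep_var_rv2[OF ind]
  by (auto intro!: borel_measurable_continuous_on[where f="\<lambda>m. m $ i $ j"] continuous_intros)

lemma entry_indep: "indep_vars (\<lambda>_. borel) entry entries"
  unfolding entry_def
proof (rule indep_vars_combine[OF _ _ ind])
  have nth: "(\<lambda>m :: ((real, 'n) vec, 'n) vec. m $ i $ j) \<in> borel_measurable borel" for i j
    by (intro borel_measurable_continuous_onI continuous_intros)
  show "\<exists>f\<in>borel_measurable borel. (case p of (i, j) \<Rightarrow> \<lambda>\<omega>. A \<omega> $ i $ j) = f \<circ> A" for p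
    using nth[of "fst p" "snd p"] by (intro bexI[of _ "\<lambda>m. m $ fst p $ snd p"]) (auto split: prod.split)
  show "\<exists>f\<in>borel_measurable borel. (case p of (i, j) \<Rightarrow> \<lambda>\<omega>. Z \<omega> $ i $ j) = f \<circ> Z" for p
    using nth[of "fst p" "snd p"] by (intro bexI[of _ "\<lambda>m. m $ fst p $ snd p"]) (auto split: prod.split)
qed (use A Z in \<open>auto simp: gaussian_wigner_def\<close>)

lemma entry_distributed:
  "e \<in> entries \<Longrightarrow> distributed M lborel (entry e) (normal_density 0 (sd e))"
  using gaussian_wigner_entry_distributed[OF A] gaussian_wigner_entry_distributed[OF Z]
  by (auto simp: entry_def sd_def)

lemma sd_bounds:
  assumes "e \<in> entries"
  shows "0 < sd e" "(sd e)\<^sup>2 \<le> 2 / real CARD('n)" "1 / real CARD('n) \<le> (sd e)\<^sup>2"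
  by (auto simp: sd_def entry_sd_def divide_right_mono split: sum.split)

lemma sd_upair:
  "(sd (Inl (upair i j)))\<^sup>2 = (1 + of_bool (i = j)) / real CARD('n)"
  "(sd (Inr (upair i j)))\<^sup>2 = (1 + of_bool (i = j)) / real CARD('n)"
  by (simp_all add: sd_def entry_sd_upair)

lemma entry_upair:
  assumes "\<omega> \<in> space M"
  shows "entry (Inl (upair i j)) \<omega> = A \<omega> $ i $ j" "entry (Inr (upair i j)) \<omega> = Z \<omega> $ i $ j"
  using gaussian_wigner_upair[OF A assms] gaussian_wigner_upair[OF Z assms]
  by (simp_all add: entry_def)

lemma upair_mem_entries: "Inl (upair i j) \<in> entries" "Inr (upair i j) \<in> entries"
  by (rule InlI InrI, rule upair_mem)+

section \<open>Tails of the pieces of an entry of \<open>A X B\<close>\<close>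

lemma cross_sum_tails:
  assumes x: "inj x" and n: "3 \<le> CARD('n)" and t: "0 < t" "t \<le> 2 / 3"
  shows "prob {\<omega>\<in>space M. t \<le> (\<Sum>k\<in>UNIV. A \<omega> $ i $ k * Z \<omega> $ x k $ j)} \<le> exp (- 3 / 16 * real CARD('n) * t\<^sup>2)"
    and "prob {\<omega>\<in>space M. (\<Sum>k\<in>UNIV. A \<omega> $ i $ k * Z \<omega> $ x k $ j) \<le> - t} \<le> exp (- 3 / 16 * real CARD('n) * t\<^sup>2)"
proof -
  let ?e = "\<lambda>k. Inl (upair i k) :: ('n \<times> 'n) + ('n \<times> 'n)" and ?e' = "\<lambda>k. Inr (upair (x k) j) :: ('n \<times> 'n) + ('n \<times> 'n)"
  \<comment> \<open>An entry of \<open>A\<close> never coincides with one of \<open>Z\<close>, and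
    both index maps are injective in \<open>k\<close>, the second by \<open>inj x\<close>. Hence no
    index has to be removed.\<close>
  have disj: "disjoint_family_on (\<lambda>k. {?e k, ?e' k}) UNIV"
    using x by (auto simp: disjoint_family_on_def upair_eq_iff inj_eq)
  have tot: "(\<Sum>k\<in>UNIV. (sd (?e k) * sd (?e' k))\<^sup>2) \<le> 2 / real CARD('n)"
    using sum_variance_products_le[OF x n] by (simp add: power_mult_distrib sd_upair)
  note * = sum_products_tails[OF entry_indep entry_distributed sd_bounds(1) _ _ disj _
      sd_bounds(2) tot t]
  show "prob {\<omega>\<in>space M. t \<le> (\<Sum>k\<in>UNIV. A \<omega> $ i $ k * Z \<omega> $ x k $ j)} \<le> exp (- 3 / 16 * real CARD('n) * t\<^sup>2)"
    using *(1) by (simp add: upair_mem_entries entry_upair cong: conj_cong)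
  show "prob {\<omega>\<in>space M. (\<Sum>k\<in>UNIV. A \<omega> $ i $ k * Z \<omega> $ x k $ j) \<le> - t} \<le> exp (- 3 / 16 * real CARD('n) * t\<^sup>2)"
    using *(2) by (simp add: upair_mem_entries entry_upair cong: conj_cong)
qed

text \<open>The index \<open>k = j\<close> is excluded because the entry \<open>A i j\<close> may occur a second time, at \<open>x k = i\<close>.\<close>

lemma off_diagonal_sum_tail:
  assumes x: "inj x" and n: "3 \<le> CARD('n)" and t: "0 < t" "t \<le> 2 / 3" and ij: "i \<noteq> j"
  shows "prob {\<omega>\<in>space M. t \<le> (\<Sum>k\<in>UNIV - {j}. A \<omega> $ i $ k * A \<omega> $ x k $ j)} \<le> exp (- 3 / 16 * real CARD('n) * t\<^sup>2)"
proof -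
  let ?e = "\<lambda>k. Inl (upair i k) :: ('n \<times> 'n) + ('n \<times> 'n)" and ?e' = "\<lambda>k. Inl (upair (x k) j) :: ('n \<times> 'n) + ('n \<times> 'n)"
  have disj: "disjoint_family_on (\<lambda>k. {?e k, ?e' k}) (UNIV - {j})"
    using x ij by (auto simp: disjoint_family_on_def upair_eq_iff inj_eq)
  have tot: "(\<Sum>k\<in>UNIV - {j}. (sd (?e k) * sd (?e' k))\<^sup>2) \<le> 2 / real CARD('n)"
    using sum_variance_products_le[OF x n] by (simp add: power_mult_distrib sd_upair)
  have ne: "?e k \<noteq> ?e' k" if "k \<in> UNIV - {j}" for k
    using that ij by (auto simp: upair_eq_iff)
  note * = sum_products_tails(1)[OF entry_indep entry_distributed sd_bounds(1) _ _ disj _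
      sd_bounds(2) tot t]
  show ?thesis
    using * ne by (simp add: upair_mem_entries entry_upair cong: conj_cong)
qed

text \<open>The entries at \<open>(i, k)\<close> and \<open>(x k', i)\<close> coincide exactly when
  \<open>k = x k'\<close>, so the pairs are disjoint once \<open>G\<close> never contains both an
  index and its image. Colour classes of the non-fixed points have this property.\<close>

lemma colour_class_sum_tail:
  assumes x: "inj x" and n: "3 \<le> CARD('n)" and t: "0 < t" "t \<le> 2 / 3"
    and G: "\<And>k. k \<in> G \<Longrightarrow> x k \<notin> G"
  shows "prob {\<omega>\<in>space M. (\<Sum>k\<in>G. A \<omega> $ i $ k * A \<omega> $ x k $ i) \<le> - t} \<le> exp (- 3 / 16 * real CARD('n) * t\<^sup>2)"
proof -
  let ?e = "\<lambda>k. Inl (upair i k) :: ('n \<times> 'n) + ('n \<times> 'n)" and ?e' = "\<lambda>k. Inl (upair (x k) i) :: ('n \<times> 'n) + ('n \<times> 'n)"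
  have disj: "disjoint_family_on (\<lambda>k. {?e k, ?e' k}) G"
    using x G by (auto simp: disjoint_family_on_def upair_eq_iff inj_eq)
  have tot: "(\<Sum>k\<in>G. (sd (?e k) * sd (?e' k))\<^sup>2) \<le> 2 / real CARD('n)"
    using sum_variance_products_le[OF x n] by (simp add: power_mult_distrib sd_upair)
  have ne: "?e k \<noteq> ?e' k" if "k \<in> G" for k
    using that G[OF that] by (auto simp: upair_eq_iff)
  note * = sum_products_tails(2)[OF entry_indep entry_distributed sd_bounds(1) _ _ disj _
      sd_bounds(2) tot t]
  show ?thesis
    using * ne by (simp add: upair_mem_entries entry_upair cong: conj_cong)
qed

lemma entry_product_tail:
  "prob {\<omega>\<in>space M. u \<le> A \<omega> $ i $ j * A \<omega> $ k $ l} \<le> 3 * exp (- real CARD('n) * u / 8)"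
  using single_product_tail[OF entry_distributed sd_bounds(1,2) entry_distributed sd_bounds(1,2),
      of "Inl (upair i j)" "Inl (upair k l)" u]
  by (simp add: upair_mem_entries entry_upair cong: conj_cong)

lemma row_squares_lower_tail:
  fixes g :: real
  assumes g: "0 < g" "g \<le> 1"
  shows "prob {\<omega>\<in>space M. (\<Sum>k\<in>G. (A \<omega> $ i $ k)\<^sup>2) \<le> (1 - g) * (card G / real CARD('n))} \<le> exp (- real (card G) * g\<^sup>2 / 8)"
proof -
  let ?e = "\<lambda>k. Inl (upair i k) :: ('n \<times> 'n) + ('n \<times> 'n)"
  have "?e ` G \<subseteq> entries" by (intro image_subsetI upair_mem_entries)
  moreover have "inj_on ?e G" by (auto simp: inj_on_def upair_eq_iff)
  ultimately have "?e ` G \<subseteq> entries" "inj_on ?e G" .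
  from sum_squares_lower_tail[OF entry_indep entry_distributed sd_bounds(1) _ this _ sd_bounds(3) g]
  show ?thesis by (simp add: entry_upair cong: conj_cong)
qed

end

section \<open>Assembling the bounds on off-diagonal and diagonal entries\<close>

context independent_wigner_pair
begin

lemma product_entry_cross_expand:
  "(\<Sum>k\<in>G. A \<omega> $ i $ k * (a * A \<omega> $ x k $ j + s * Z \<omega> $ x k $ j))
    = a * (\<Sum>k\<in>G. A \<omega> $ i $ k * A \<omega> $ x k $ j) + s * (\<Sum>k\<in>G. A \<omega> $ i $ k * Z \<omega> $ x k $ j)"
  by (simp add: sum.distrib sum_distrib_left algebra_simps)

text \<open>In units of \<open>a * s\<close> the budget is
  \<open>3 / 25 + 13 / 100 + 3 / 25 = 37 / 100\<close>: the sum without index \<open>j\<close>, the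
  single product at \<open>j\<close>, and the noise sum, whose weight \<open>\<sigma>\<close> is at
  most 1. The single product has prefactor 3 and the other two have 1, which gives the 5.\<close>

lemma off_diagonal_upper_tail:
  assumes x: "inj x" and n: "10 \<le> CARD('n)" and s0: "0 \<le> \<sigma>" "\<sigma> < 1"
    and s: "0 < s" "s \<le> 1" and ij: "i \<noteq> j"
  defines "a \<equiv> sqrt (1 - \<sigma>\<^sup>2)"
  shows "prob {\<omega>\<in>space M. 37 / 100 * a * s
      \<le> (\<Sum>k\<in>UNIV. A \<omega> $ i $ k * (a * A \<omega> $ x k $ j + \<sigma> * Z \<omega> $ x k $ j))}
    \<le> 5 * exp (- rate_const \<sigma> * s\<^sup>2 * real CARD('n))"
    (is "prob ?E \<le> 5 * exp (- ?r * s\<^sup>2 * ?n)")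
proof -
  have sq: "\<sigma>\<^sup>2 < 1" using s0 by (simp add: power_less_one_iff)
  have a: "0 < a" "a \<le> 1" using sq by (auto simp: a_def)
  have as: "0 < a * s" "a * s \<le> 1" using a s mult_le_one[of a s] by auto
  have s2: "s\<^sup>2 \<le> s" using s by (simp add: power2_eq_square mult_left_le_one_le)
  define e where "e = rate_const \<sigma> * s\<^sup>2 * ?n"
  note rs = rate_const_exponent_le[OF s0 of_nat_0_le_iff, of s "CARD('n)", folded a_def e_def]
  \<comment> \<open>The tail of the single product has an exponent linear in \<open>s\<close>; since
    \<open>s \<le> 1\<close>, it can be compared with the quadratic exponent
    \<open>e\<close>.\<close>
  have rs': "e \<le> s * ?n / 384"
    using rs(1) mult_right_mono[OF s2, of ?n] by linarith
  have sn: "0 \<le> s * ?n" using s(1) by simp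
  define D1 where "D1 \<omega> = (\<Sum>k\<in>UNIV - {j}. A \<omega> $ i $ k * A \<omega> $ x k $ j)" for \<omega>
  define D2 where "D2 \<omega> = A \<omega> $ i $ j * A \<omega> $ x j $ j" for \<omega>
  define D3 where "D3 \<omega> = (\<Sum>k\<in>UNIV. A \<omega> $ i $ k * Z \<omega> $ x k $ j)" for \<omega>
  have [measurable]: "D1 \<in> borel_measurable M" "D2 \<in> borel_measurable M" "D3 \<in> borel_measurable M"
    unfolding D1_def[abs_def] D2_def[abs_def] D3_def[abs_def] by measurable
  let ?E1 = "{\<omega>\<in>space M. 3 / 25 * s \<le> D1 \<omega>}"
  let ?E2 = "{\<omega>\<in>space M. 13 / 100 * s \<le> D2 \<omega>}"
  let ?E3 = "{\<omega>\<in>space M. 3 / 25 * (a * s) \<le> D3 \<omega>}"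
  have "?E \<subseteq> ?E1 \<union> (?E2 \<union> ?E3)"
  proof (rule subsetI, rule ccontr)
    fix \<omega> assume "\<omega> \<in> ?E" "\<omega> \<notin> ?E1 \<union> (?E2 \<union> ?E3)"
    then have neg: "D1 \<omega> < 3 / 25 * s" "D2 \<omega> < 13 / 100 * s" "D3 \<omega> < 3 / 25 * (a * s)"
      and big: "37 / 100 * a * s \<le> (\<Sum>k\<in>UNIV. A \<omega> $ i $ k * (a * A \<omega> $ x k $ j + \<sigma> * Z \<omega> $ x k $ j))"
      by auto
    have "(\<Sum>k\<in>UNIV. A \<omega> $ i $ k * A \<omega> $ x k $ j) = D2 \<omega> + D1 \<omega>"
      unfolding D1_def D2_def by (rule sum.remove) auto
    then have "37 / 100 * a * s \<le> a * (D2 \<omega> + D1 \<omega>) + \<sigma> * D3 \<omega>"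
      using big unfolding product_entry_cross_expand by (simp add: D3_def)
    also have "\<sigma> * D3 \<omega> \<le> \<sigma> * (3 / 25 * (a * s))" using neg s0 by (intro mult_left_mono) auto
    also have "\<dots> \<le> 1 * (3 / 25 * (a * s))" using s0 as by (intro mult_right_mono) auto
    finally have "a * (25 / 100 * s) \<le> a * (D2 \<omega> + D1 \<omega>)" by (simp add: algebra_simps)
    then have "25 / 100 * s \<le> D2 \<omega> + D1 \<omega>" using a by simp
    then show False using neg by simp
  qed
  then have "prob ?E \<le> prob (?E1 \<union> (?E2 \<union> ?E3))" by (intro finite_measure_mono) auto
  also have "\<dots> \<le> prob ?E1 + (prob ?E2 + prob ?E3)"
    by (rule order_trans[OF measure_Un_le] add_left_mono measure_Un_le; measurable)+
  also have "prob ?E1 \<le> exp (- e)"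
  proof -
    have "prob ?E1 \<le> exp (- 3 / 16 * ?n * (3 / 25 * s)\<^sup>2)"
      unfolding D1_def using n s ij by (intro off_diagonal_sum_tail x) auto
    also have "\<dots> \<le> exp (- e)"
      using rs(1) by (rule exp_product_tail_le[OF of_nat_0_le_iff])
    finally show ?thesis .
  qed
  also have "prob ?E2 \<le> 3 * exp (- e)"
  proof -
    have "prob ?E2 \<le> 3 * exp (- ?n * (13 / 100 * s) / 8)"
      unfolding D2_def by (rule entry_product_tail)
    also have "\<dots> \<le> 3 * exp (- e)"
    proof -
      have "- ?n * (13 / 100 * s) / 8 = - (13 / 800) * (s * ?n)" by simp
      also have "\<dots> \<le> - e" using rs' sn by linarith
      finally show ?thesis by simp
    qed
    finally show ?thesis .
  qed
  also have "prob ?E3 \<le> exp (- e)"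
  proof -
    have "prob ?E3 \<le> exp (- 3 / 16 * ?n * (3 / 25 * (a * s))\<^sup>2)"
      unfolding D3_def using n as by (intro cross_sum_tails x) auto
    also have "\<dots> \<le> exp (- e)"
      using rs(2) by (rule exp_product_tail_le[OF of_nat_0_le_iff])
    finally show ?thesis .
  qed
  finally show ?thesis by (simp add: e_def)
qed

text \<open>In units of \<open>a * s\<close> the budget is
  \<open>85 / 100 - 3 * 12 / 100 - 12 / 100 = 37 / 100\<close>: the squares at the fixed points,
  three colour classes of non-fixed points, and the noise sum. Each of these five events costs one
  \<open>exp (- e)\<close>.\<close>

lemma diagonal_lower_tail:
  assumes x: "inj x" and n: "10 \<le> CARD('n)" and s0: "0 \<le> \<sigma>" "\<sigma> < 1"
    and s: "0 < s" "s = card {k. x k = k} / real CARD('n)"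
  defines "a \<equiv> sqrt (1 - \<sigma>\<^sup>2)"
  shows "prob {\<omega>\<in>space M.
      (\<Sum>k\<in>UNIV. A \<omega> $ i $ k * (a * A \<omega> $ x k $ i + \<sigma> * Z \<omega> $ x k $ i)) \<le> 37 / 100 * a * s}
    \<le> 5 * exp (- rate_const \<sigma> * s\<^sup>2 * real CARD('n))"
    (is "prob ?E \<le> 5 * exp (- ?r * s\<^sup>2 * ?n)")
proof -
  have s1: "s \<le> 1" unfolding s by (simp add: divide_le_eq card_mono)
  have sq: "\<sigma>\<^sup>2 < 1" using s0 by (simp add: power_less_one_iff)
  have a: "0 < a" "a \<le> 1" using sq by (auto simp: a_def)
  have as: "0 < a * s" "a * s \<le> 1" using a s(1) s1 mult_le_one[of a s] by auto
  have s2: "s\<^sup>2 \<le> s" using s(1) s1 by (simp add: power2_eq_square mult_left_le_one_le)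
  define e where "e = rate_const \<sigma> * s\<^sup>2 * ?n"
  note rs = rate_const_exponent_le[OF s0 of_nat_0_le_iff, of s "CARD('n)", folded a_def e_def]
  have rs': "e \<le> s * ?n / 384"
    using rs(1) mult_right_mono[OF s2, of ?n] by linarith
  have sn: "0 \<le> s * ?n" using s(1) by simp
  obtain c :: "'n \<Rightarrow> nat" where c: "\<And>k. c k < 3" "\<And>k. x k \<noteq> k \<Longrightarrow> c (x k) \<noteq> c k"
    using perm_three_colouring[OF x] by blast
  define G where "G g = {k. x k \<noteq> k \<and> c k = g}" for g
  define Q where "Q \<omega> = (\<Sum>k\<in>{k. x k = k}. (A \<omega> $ i $ k)\<^sup>2)" for \<omega>
  define N where "N g \<omega> = (\<Sum>k\<in>G g. A \<omega> $ i $ k * A \<omega> $ x k $ i)" for g \<omega>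
  define D where "D \<omega> = (\<Sum>k\<in>UNIV. A \<omega> $ i $ k * Z \<omega> $ x k $ i)" for \<omega>
  have [measurable]: "Q \<in> borel_measurable M" "N g \<in> borel_measurable M" "D \<in> borel_measurable M" for g
    unfolding Q_def[abs_def] N_def[abs_def] D_def[abs_def] by measurable
  have split: "(\<Sum>k\<in>UNIV. A \<omega> $ i $ k * A \<omega> $ x k $ i) = Q \<omega> + (N 0 \<omega> + N 1 \<omega> + N 2 \<omega>)"
    if w: "\<omega> \<in> space M" for \<omega>
  proof -
    note sym = gaussian_wigner_symmetric[OF A w, of _ i]
    have cases: "- {k. x k = k} = G 0 \<union> G 1 \<union> G 2"
    proof -
      have "c k = 0 \<or> c k = 1 \<or> c k = 2" for k using c(1)[of k] by linarith
      then show ?thesis by (auto simp: G_def)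
    qed
    have "(\<Sum>k\<in>UNIV. A \<omega> $ i $ k * A \<omega> $ x k $ i)
        = (\<Sum>k\<in>{k. x k = k}. A \<omega> $ i $ k * A \<omega> $ x k $ i)
          + (\<Sum>k\<in>- {k. x k = k}. A \<omega> $ i $ k * A \<omega> $ x k $ i)"
      by (subst sum.union_disjoint[symmetric]) (auto simp: Un_commute)
    also have "(\<Sum>k\<in>{k. x k = k}. A \<omega> $ i $ k * A \<omega> $ x k $ i) = Q \<omega>"
      unfolding Q_def by (intro sum.cong) (auto simp: sym power2_eq_square)
    also have "(\<Sum>k\<in>- {k. x k = k}. A \<omega> $ i $ k * A \<omega> $ x k $ i) = N 0 \<omega> + N 1 \<omega> + N 2 \<omega>"
      unfolding cases N_def by (subst sum.union_disjoint; (auto simp: G_def)?)+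
    finally show ?thesis .
  qed
  let ?Q = "{\<omega>\<in>space M. Q \<omega> \<le> (1 - 3 / 20) * s}"
  let ?N = "\<lambda>g. {\<omega>\<in>space M. N g \<omega> \<le> - (3 / 25 * s)}"
  let ?D = "{\<omega>\<in>space M. D \<omega> \<le> - (3 / 25 * (a * s))}"
  have "?E \<subseteq> ?Q \<union> (?N 0 \<union> (?N 1 \<union> (?N 2 \<union> ?D)))"
  proof (rule subsetI, rule ccontr)
    fix \<omega> assume "\<omega> \<in> ?E" and "\<omega> \<notin> ?Q \<union> (?N 0 \<union> (?N 1 \<union> (?N 2 \<union> ?D)))"
    then have w: "\<omega> \<in> space M"
      and small: "a * (Q \<omega> + (N 0 \<omega> + N 1 \<omega> + N 2 \<omega>)) + \<sigma> * D \<omega> \<le> 37 / 100 * a * s"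
      and neg: "(1 - 3 / 20) * s < Q \<omega>" "- (3 / 25 * s) < N 0 \<omega>" "- (3 / 25 * s) < N 1 \<omega>"
        "- (3 / 25 * s) < N 2 \<omega>" "- (3 / 25 * (a * s)) < D \<omega>"
      by (auto simp: product_entry_cross_expand split D_def[symmetric])
    have "- (3 / 25 * (a * s)) = - (1 * (3 / 25 * (a * s)))" by simp
    also have "\<dots> \<le> - (\<sigma> * (3 / 25 * (a * s)))"
      unfolding neg_le_iff_le using s0 as by (intro mult_right_mono) auto
    also have "\<dots> \<le> \<sigma> * D \<omega>"
      using mult_left_mono[of "- (3 / 25 * (a * s))" "D \<omega>" \<sigma>] neg s0 by simp
    finally have "a * (Q \<omega> + (N 0 \<omega> + N 1 \<omega> + N 2 \<omega>)) \<le> a * (49 / 100 * s)"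
      using small by (simp add: algebra_simps)
    then have "Q \<omega> + (N 0 \<omega> + N 1 \<omega> + N 2 \<omega>) \<le> 49 / 100 * s" using a by simp
    then show False using neg by simp
  qed
  then have "prob ?E \<le> prob (?Q \<union> (?N 0 \<union> (?N 1 \<union> (?N 2 \<union> ?D))))" by (intro finite_measure_mono) auto
  also have "\<dots> \<le> prob ?Q + (prob (?N 0) + (prob (?N 1) + (prob (?N 2) + prob ?D)))"
    by (rule order_trans[OF measure_Un_le] add_left_mono measure_Un_le; measurable)+
  also have "prob ?Q \<le> exp (- e)"
  proof -
    have m: "real (card {k. x k = k}) = s * ?n" by (simp add: s(2))
    \<comment> \<open>The relative loss \<open>3 / 20\<close> is large enough, since
      \<open>(3 / 20)\<^sup>2 / 8 = 9 / 3200\<close> exceeds \<open>1 / 384\<close>.\<close>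
    have "prob ?Q \<le> exp (- (s * ?n) * (3 / 20)\<^sup>2 / 8)"
      using row_squares_lower_tail[of "3 / 20" i "{k. x k = k}"] unfolding m Q_def by simp
    also have "\<dots> \<le> exp (- e)"
    proof -
      have "- (s * ?n) * (3 / 20)\<^sup>2 / 8 = - (9 / 3200) * (s * ?n)" by (simp add: power2_eq_square)
      also have "\<dots> \<le> - e" using rs' sn by linarith
      finally show ?thesis by simp
    qed
    finally show ?thesis .
  qed
  also have N: "prob (?N g) \<le> exp (- e)" for g
  proof -
    have "prob (?N g) \<le> exp (- 3 / 16 * ?n * (3 / 25 * s)\<^sup>2)"
      unfolding N_def using n s(1) s1 c(2) by (intro colour_class_sum_tail x) (auto simp: G_def)
    also have "\<dots> \<le> exp (- e)"
      using rs(1) by (rule exp_product_tail_le[OF of_nat_0_le_iff])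
    finally show ?thesis .
  qed
  note N[of 0] also note N[of 1] also note N[of 2]
  also have "prob ?D \<le> exp (- e)"
  proof -
    have "prob ?D \<le> exp (- 3 / 16 * ?n * (3 / 25 * (a * s))\<^sup>2)"
      unfolding D_def using n as by (intro cross_sum_tails x) auto
    also have "\<dots> \<le> exp (- e)"
      using rs(2) by (rule exp_product_tail_le[OF of_nat_0_le_iff])
    finally show ?thesis .
  qed
  finally show ?thesis by (simp add: e_def)
qed

end

section \<open>Union bound over \<open>r\<close> indices and the final estimates\<close>

lemma (in prob_space) one_step_overlap_prob:
  fixes A B :: "'a \<Rightarrow> real ^ 'n::{finite,linorder} ^ 'n::{finite,linorder}"
    and \<pi> :: "'a \<Rightarrow> 'n \<Rightarrow> 'n"
  assumes n: "10 \<le> CARD('n)" and s0: "0 \<le> \<sigma>" "\<sigma> < 1"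
    and AB: "correlated_wigner M \<sigma> A B"
    and x: "inj x"
    and \<pi>: "\<pi> \<in> measurable M (count_space perms)"
      "\<forall>\<omega>\<in>space M. ppmgm (A \<omega>) (B \<omega>) (perm_matrix x) 1 (perm_matrix (\<pi> \<omega>))"
    and r: "r \<le> CARD('n)"
    and s: "0 < s" "s = card {k. x k = k} / real CARD('n)"
  shows "\<P>(\<omega> in M. overlap (\<pi> \<omega>) id \<ge> real r / real CARD('n))
    \<ge> 1 - 16 * real r * real CARD('n) * exp (- rate_const \<sigma> * s\<^sup>2 * real CARD('n))"
proof -
  obtain Z where A: "gaussian_wigner M A" and Z: "gaussian_wigner M Z" and ind: "indep_var borel A borel Z"
    and B: "\<And>\<omega>. \<omega> \<in> space M \<Longrightarrow> B \<omega> = sqrt (1 - \<sigma>\<^sup>2) *\<^sub>R A \<omega> + \<sigma> *\<^sub>R Z \<omega>"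
    using AB unfolding correlated_wigner_def by blast
  interpret independent_wigner_pair M A Z by unfold_locales (fact A Z ind)+
  have s1: "s \<le> 1" unfolding s by (simp add: divide_le_eq card_mono)
  define a where "a = sqrt (1 - \<sigma>\<^sup>2)"
  define C where "C \<omega> i j = (\<Sum>k\<in>UNIV. A \<omega> $ i $ k * (a * A \<omega> $ x k $ j + \<sigma> * Z \<omega> $ x k $ j))" for \<omega> i j
  define t where "t = 37 / 100 * a * s"
  define q where "q = exp (- rate_const \<sigma> * s\<^sup>2 * real CARD('n))"
  have C: "(A \<omega> ** perm_matrix x ** B \<omega>) $ i $ j = C \<omega> i j" if "\<omega> \<in> space M" for \<omega> i j
    using B[OF that] by (simp add: perm_matrix_sandwich C_def a_def)
  have [measurable]: "(\<lambda>\<omega>. C \<omega> i j) \<in> borel_measurable M" for i j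
    unfolding C_def by measurable
  \<comment> \<open>Any \<open>r\<close> indices will do: if \<open>\<pi> \<omega>\<close> fixes all
    of them, the overlap is already \<open>r / n\<close>. Thus the union bound costs a factor
    \<open>r\<close> for the choice of indices.\<close>
  obtain T :: "'n set" where T: "card T = r" using r obtain_subset_with_card_n[of r UNIV] by blast
  define bad where "bad i = {\<omega>\<in>space M. C \<omega> i i \<le> t}
    \<union> (\<Union>j\<in>- {i}. {\<omega>\<in>space M. t \<le> C \<omega> i j} \<union> {\<omega>\<in>space M. t \<le> C \<omega> j i})" for i
  have bad_sets: "bad i \<in> events" for i
    unfolding bad_def by (intro sets.Un sets.finite_UN) auto
  \<comment> \<open>One diagonal event and \<open>2 * (n - 1)\<close> off-diagonal events at
    \<open>5 * q\<close> each add up to \<open>(10 * n - 5) * q\<close>.\<close>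
  have bad_prob: "prob (bad i) \<le> 10 * real CARD('n) * q" for i
  proof -
    have off: "prob {\<omega>\<in>space M. t \<le> C \<omega> k l} \<le> 5 * q" if "k \<noteq> l" for k l
      unfolding t_def C_def q_def a_def by (rule off_diagonal_upper_tail[OF x n s0 s(1) s1 that])
    have "prob (\<Union>j\<in>- {i}. {\<omega>\<in>space M. t \<le> C \<omega> i j} \<union> {\<omega>\<in>space M. t \<le> C \<omega> j i})
        \<le> (\<Sum>j\<in>- {i}. prob ({\<omega>\<in>space M. t \<le> C \<omega> i j} \<union> {\<omega>\<in>space M. t \<le> C \<omega> j i}))"
      by (rule measure_UNION_le) auto
    also have "\<dots> \<le> (\<Sum>j\<in>- {i}. 10 * q)"
    proof (rule sum_mono)
      fix j assume j: "j \<in> - {i}"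
      have "prob ({\<omega>\<in>space M. t \<le> C \<omega> i j} \<union> {\<omega>\<in>space M. t \<le> C \<omega> j i})
          \<le> prob {\<omega>\<in>space M. t \<le> C \<omega> i j} + prob {\<omega>\<in>space M. t \<le> C \<omega> j i}"
        by (rule measure_Un_le) auto
      then show "prob ({\<omega>\<in>space M. t \<le> C \<omega> i j} \<union> {\<omega>\<in>space M. t \<le> C \<omega> j i}) \<le> 10 * q"
        using off[of i j] off[of j i] j by auto
    qed
    also have "\<dots> = (real CARD('n) - 1) * (10 * q)"
      using n by (simp add: Compl_eq_Diff_UNIV card_Diff_subset of_nat_diff)
    finally have "prob (\<Union>j\<in>- {i}. {\<omega>\<in>space M. t \<le> C \<omega> i j} \<union> {\<omega>\<in>space M. t \<le> C \<omega> j i})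
      \<le> (real CARD('n) - 1) * (10 * q)" .
    moreover have "prob {\<omega>\<in>space M. C \<omega> i i \<le> t} \<le> 5 * q"
      unfolding t_def C_def q_def a_def by (rule diagonal_lower_tail[OF x n s0 s])
    moreover have "prob (bad i) \<le> prob {\<omega>\<in>space M. C \<omega> i i \<le> t}
        + prob (\<Union>j\<in>- {i}. {\<omega>\<in>space M. t \<le> C \<omega> i j} \<union> {\<omega>\<in>space M. t \<le> C \<omega> j i})"
      unfolding bad_def by (rule measure_Un_le) auto
    moreover have "0 \<le> q" by (simp add: q_def)
    ultimately show ?thesis by (simp add: algebra_simps)
  qed
  have good: "\<pi> \<omega> i = i" if w: "\<omega> \<in> space M" and "\<omega> \<notin> bad i" for \<omega> i
  proof (rule gmwm_fixes_dominant)
    show "gmwm (A \<omega> ** perm_matrix x ** B \<omega>) (perm_matrix (\<pi> \<omega>))"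
      using \<pi>(2) w ppmgm_one_iff by blast
    show "(A \<omega> ** perm_matrix x ** B \<omega>) $ i $ j < (A \<omega> ** perm_matrix x ** B \<omega>) $ i $ i \<and>
        (A \<omega> ** perm_matrix x ** B \<omega>) $ j $ i < (A \<omega> ** perm_matrix x ** B \<omega>) $ i $ i" if "j \<noteq> i" for j
      using \<open>\<omega> \<notin> bad i\<close> w that unfolding bad_def C[OF w] by force
  qed
  let ?O = "{\<omega>\<in>space M. overlap (\<pi> \<omega>) id \<ge> real r / real CARD('n)}"
  have O: "?O \<in> events"
    using measurable_compose[OF \<pi>(1), of "\<lambda>p. overlap p id" borel] by measurable
  have "space M - ?O \<subseteq> (\<Union>i\<in>T. bad i)"
  proof (rule subsetI, rule ccontr)
    fix \<omega> assume w: "\<omega> \<in> space M - ?O" and "\<omega> \<notin> (\<Union>i\<in>T. bad i)"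
    then have "T \<subseteq> {i. \<pi> \<omega> i = id i}" using good by auto
    then have "r \<le> card {i. \<pi> \<omega> i = id i}" using T card_mono[of _ T] by (metis finite)
    then have "\<omega> \<in> ?O" using w by (auto simp: overlap_def divide_right_mono)
    then show False using w by blast
  qed
  then have "1 - prob ?O \<le> prob (\<Union>i\<in>T. bad i)"
    using O bad_sets by (subst prob_compl[symmetric]) (auto intro!: finite_measure_mono)
  also have "\<dots> \<le> (\<Sum>i\<in>T. prob (bad i))" by (rule measure_UNION_le) (use bad_sets in auto)
  also have "\<dots> \<le> (\<Sum>i\<in>T. 10 * real CARD('n) * q)" by (intro sum_mono bad_prob)
  also have "\<dots> = 10 * (real r * real CARD('n) * q)" using T by simp
  \<comment> \<open>The union bound yields the constant 10, which is relaxed to the claimed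
    16.\<close>
  also have "\<dots> \<le> 16 * (real r * real CARD('n) * q)" by (intro mult_right_mono) (auto simp: q_def)
  finally show ?thesis by (simp add: q_def mult.assoc)
qed

theorem theorem2:
  fixes M :: "'a measure"
    and A B :: "'a \<Rightarrow> real ^ 'n::{finite,linorder} ^ 'n::{finite,linorder}"
    and X :: "real ^ 'n::{finite,linorder} ^ 'n::{finite,linorder}"
    and \<pi> :: "'a \<Rightarrow> 'n \<Rightarrow> 'n"
    and \<sigma> \<theta> :: real
    and n r :: nat
  assumes "prob_space M"
    and "n = CARD('n)" and "n \<ge> 10"
    and "0 \<le> \<sigma>" and "\<sigma> < 1"
    and "correlated_wigner M \<sigma> A B"
    and "X \<in> perm_matrices"
    and "0 \<le> \<theta>" and "\<theta> \<le> sqrt (2 * (1 - 10 / real n))"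
    and "norm (X - mat 1) \<le> \<theta> * sqrt (real n)"
    and "\<pi> \<in> measurable M (count_space perms)"
    and "\<forall>\<omega>\<in>space M. ppmgm (A \<omega>) (B \<omega>) X 1 (perm_matrix (\<pi> \<omega>))"
    and "r \<in> {1..n}"
  shows "\<P>(\<omega> in M. overlap (\<pi> \<omega>) id \<ge> real r / real n)
           \<ge> 1 - 16 * real r * real n * exp (- rate_const \<sigma> * (1 - \<theta>\<^sup>2 / 2)\<^sup>2 * real n)
       \<and> (real (card (fixed_points X))
             \<ge> sqrt (1 / rate_const \<sigma> * real n * ln (16 * real r * (real n)\<^sup>2))
          \<longrightarrow> \<P>(\<omega> in M. overlap (\<pi> \<omega>) id \<ge> real r / real n) \<ge> 1 - 1 / real n)"
proof -
  interpret prob_space M by fact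
  obtain x where x: "x permutes UNIV" and X: "X = perm_matrix x"
    using \<open>X \<in> perm_matrices\<close> by (auto simp: perm_matrices_def)
  have n: "0 < real n" and n10: "10 \<le> CARD('n)" using assms(2,3) by auto
  have c: "0 < rate_const \<sigma>" using assms(4,5) by (rule rate_const_pos)
  define m where "m = real (card (fixed_points X))"
  define s where "s = m / real n"
  have m: "m = s * real n" using n by (simp add: s_def)
  \<comment> \<open>The Frobenius hypothesis bounds the number of non-fixed points, which gives
    \<open>1 - \<theta>\<^sup>2 / 2 \<le> s\<close>.\<close>
  have "2 * (real n - m) = (norm (X - mat 1))\<^sup>2"
    by (simp add: norm_perm_matrix_diff X m_def fixed_points_perm_matrix assms(2))
  also have "\<dots> \<le> (\<theta> * sqrt (real n))\<^sup>2" using assms(10) by (intro power_mono) auto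
  also have "\<dots> = \<theta>\<^sup>2 * real n" by (simp add: power_mult_distrib)
  finally have "1 - \<theta>\<^sup>2 / 2 \<le> s" using n by (simp add: s_def field_simps)
  \<comment> \<open>The bound on \<open>\<theta>\<close> means
    \<open>1 - \<theta>\<^sup>2 / 2 \<ge> 10 / n\<close>. This makes \<open>s\<close> positive and
    allows squares to be compared later.\<close>
  moreover have "\<theta>\<^sup>2 \<le> 2 * (1 - 10 / real n)"
    using power_mono[OF assms(9,8), of 2] assms(3) by (subst (asm) real_sqrt_pow2) (simp_all add: field_simps)
  moreover have "0 < 10 / real n" using n by simp
  ultimately have th: "0 \<le> 1 - \<theta>\<^sup>2 / 2" "1 - \<theta>\<^sup>2 / 2 \<le> s" and s: "0 < s" by argo+
  let ?P = "\<P>(\<omega> in M. overlap (\<pi> \<omega>) id \<ge> real r / real n)"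
  \<comment> \<open>With the exact fraction \<open>s\<close> of fixed points in the exponent, both
    claims follow: the first by monotonicity in \<open>s\<close>, the second because its hypothesis
    is a lower bound on \<open>s * n\<close>.\<close>
  have core: "?P \<ge> 1 - 16 * real r * real n * exp (- rate_const \<sigma> * s\<^sup>2 * real n)"
    unfolding assms(2)
    by (rule one_step_overlap_prob[OF n10 assms(4-6) permutes_inj[OF x] assms(11)])
      (use assms(2,12,13) s in \<open>auto simp: X s_def m_def fixed_points_perm_matrix\<close>)
  show ?thesis
  proof (intro conjI impI)
    have "(1 - \<theta>\<^sup>2 / 2)\<^sup>2 \<le> s\<^sup>2" using th by (intro power_mono) auto
    then have "exp (- rate_const \<sigma> * s\<^sup>2 * real n) \<le> exp (- rate_const \<sigma> * (1 - \<theta>\<^sup>2 / 2)\<^sup>2 * real n)"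
      using c by (simp add: mult_left_mono mult_right_mono)
    then have "16 * real r * real n * exp (- rate_const \<sigma> * s\<^sup>2 * real n)
        \<le> 16 * real r * real n * exp (- rate_const \<sigma> * (1 - \<theta>\<^sup>2 / 2)\<^sup>2 * real n)"
      by (intro mult_left_mono) auto
    then show "?P \<ge> 1 - 16 * real r * real n * exp (- rate_const \<sigma> * (1 - \<theta>\<^sup>2 / 2)\<^sup>2 * real n)"
      using core by linarith
  next
    \<comment> \<open>\<open>L\<close> is the exponent at which
      \<open>16 * r * n * exp (- L)\<close> equals \<open>1 / n\<close>; squaring the hypothesis
      shows that the actual exponent is at least \<open>L\<close>.\<close>
    define L where "L = ln (16 * real r * (real n)\<^sup>2)"
    assume "real (card (fixed_points X)) \<ge> sqrt (1 / rate_const \<sigma> * real n * ln (16 * real r * (real n)\<^sup>2))"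
    then have "1 / rate_const \<sigma> * real n * L \<le> (s * real n)\<^sup>2"
      using sqrt_le_D unfolding L_def[symmetric] m_def[symmetric] m by blast
    then have "real n * L \<le> real n * (rate_const \<sigma> * s\<^sup>2 * real n)"
      using c by (simp add: field_simps power2_eq_square)
    then have "L \<le> rate_const \<sigma> * s\<^sup>2 * real n" using n by simp
    then have "exp (- rate_const \<sigma> * s\<^sup>2 * real n) \<le> exp (- L)" by simp
    also have "\<dots> = 1 / (16 * real r * (real n)\<^sup>2)"
      using n assms(13) by (simp add: L_def exp_minus inverse_eq_divide)
    finally have "16 * real r * real n * exp (- rate_const \<sigma> * s\<^sup>2 * real n)
        \<le> 16 * real r * real n * (1 / (16 * real r * (real n)\<^sup>2))"
      by (intro mult_left_mono) auto
    also have "\<dots> = 1 / real n" using n assms(13) by (simp add: power2_eq_square)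
    finally show "?P \<ge> 1 - 1 / real n" using core by linarith
  qed
qed

end
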